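(* Let $Q_0$ be a cube in $\mathbb{R}^n$ equipped with the Lebesgue measure $\mu$. Let $w$ be a weight in the class $A_1(Q_0)$ such that: (i) $w(x)\ge1$ for almost every $x\in Q_0$; (ii) $w$ has $m$ singularities $x_1,\dots,x_m$ in $Q_0$; (iii) there exist two positive numbers $\theta$ and $r$ such that $w(x)\le|x-x_i|^{-\theta}$ for almost every $x\in Q(x_i,r)\cap\overline{Q_0}$ and each $i=1,\dots,m$. Then there exists a positive number $\delta$ such that $w^{\alpha}$ (that is, $x\mapsto w(x)^{\alpha(x)}$) also belongs to $A_1(Q_0)$ for every function $\alpha$ on $Q_0$ that satisfies a log-Hölder condition and the inequality $1\le\alpha(x)\le1+\delta$ for almost every $x\in Q_0$.
   Context: $Q(x,l)$ denotes a cube in $\mathbb{R}^n$ centered at $x$ with side length $l$ and sides parallel to the coordinate axes. A weight on $Q_0$ is a measurable function $w$ with $0<w<\infty$ a.e. A weight $v$ belongs to $A_1(Q_0)$ if there is $C>0$ such that $\frac1{\mu(Q)}\int_{Q\cap Q_0}v\,d\mu\le C\,v(x)$ for a.e. $x\in Q\cap Q_0$ and every cube $Q$ (sides parallel to the axes) centered at a point of $Q_0$. A singularity of $w$ is a point $x\in\overline{Q_0}$ such that $w$ is not essentially bounded on $U\cap Q_0$ for any neighbourhood $U$ of $x$; condition (ii) means that the set of singularities of $w$ is the finite set $\{x_1,\dots,x_m\}$, contained in $Q_0$. A function $\alpha$ on $Q_0$ satisfies a log-Hölder condition if there is $C>0$ with $|\alpha(x)-\alpha(y)|\le C/\log(1/|x-y|)$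 for all $x,y\in Q_0$ with $|x-y|\le1/2$. *)

theory Defs
  imports "HOL-Analysis.Analysis"
begin

definition cube :: "'a::euclidean_space \<Rightarrow> real \<Rightarrow> 'a set" where
  "cube x l = box (x - (l/2) *\<^sub>R One) (x + (l/2) *\<^sub>R One)"

(* No convention is fixed as to which boundary points belong to a cube. The ambient cube may
   contain any part of its boundary; for the cubes that only enter through integrals and
   almost-everywhere statements the open representative "cube x l" suffices. *)
definition is_cube :: "'a::euclidean_space set \<Rightarrow> bool" where
  "is_cube Q \<longleftrightarrow> (\<exists>x l. l > 0 \<and> cube x l \<subseteq> Q \<and> Q \<subseteq> closure (cube x l))"

(* Weights are determined up to null sets, so they are taken real-valued (finite everywhere). *)
definition weight_on :: "'a::euclidean_space set \<Rightarrow> ('a \<Rightarrow> real) \<Rightarrow> bool" where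
  "weight_on Q0 w \<longleftrightarrow>
     w \<in> borel_measurable (lebesgue_on Q0) \<and> (AE x in lebesgue_on Q0. 0 < w x)"

(* The average is taken in the extended nonnegative reals, so that the bound forces local
   integrability. It is normalised by the measure of the whole cube, not of its part in Q0. *)
definition A1 :: "'a::euclidean_space set \<Rightarrow> ('a \<Rightarrow> real) set" where
  "A1 Q0 = {v. weight_on Q0 v \<and>
     (\<exists>C>0. \<forall>z\<in>Q0. \<forall>l>0. AE x in lebesgue_on (cube z l \<inter> Q0).
        (\<integral>\<^sup>+y. ennreal (v y) \<partial>lebesgue_on (cube z l \<inter> Q0)) / emeasure lebesgue (cube z l)
          \<le> ennreal (C * v x))}"

definition ess_bounded_on :: "'a::euclidean_space set \<Rightarrow> ('a \<Rightarrow> real) \<Rightarrow> bool" where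
  "ess_bounded_on S w \<longleftrightarrow> (\<exists>M. AE x in lebesgue_on S. \<bar>w x\<bar> \<le> M)"

definition singularities :: "'a::euclidean_space set \<Rightarrow> ('a \<Rightarrow> real) \<Rightarrow> 'a set" where
  "singularities Q0 w =
     {x \<in> closure Q0. \<forall>U. open U \<and> x \<in> U \<longrightarrow> \<not> ess_bounded_on (U \<inter> Q0) w}"

(* For x = y the right-hand side is C / ln (1 / 0) = 0, so this case is vacuous. *)
definition log_holder_on :: "'a::euclidean_space set \<Rightarrow> ('a \<Rightarrow> real) \<Rightarrow> bool" where
  "log_holder_on Q0 \<alpha> \<longleftrightarrow>
     (\<exists>C>0. \<forall>x\<in>Q0. \<forall>y\<in>Q0. norm (x - y) \<le> 1/2 \<longrightarrow>
        \<bar>\<alpha> x - \<alpha> y\<bar> \<le> C / ln (1 / norm (x - y)))"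

end

theory Submission
  imports Defs
begin

text \<open>
  Two mechanisms combine. The first is the self-improvement of \<open>A1\<close> weights: for some \<open>\<delta> > 0\<close> the
  power \<open>w powr (1 + \<delta>)\<close> is again in \<open>A1\<close> (\<open>A1_self_improvement\<close>), and hence so is every constant
  power \<open>w powr a\<close> with \<open>1 \<le> a \<le> 1 + \<delta>\<close> (\<open>A1_powr_interpolation\<close>). This is the \<open>\<delta>\<close> of the theorem.

  The second is that a log-Hoelder exponent can be frozen at a singularity. Near \<open>p i\<close> the weight is
  between \<open>1\<close> and \<open>\<bar>x - p i\<bar> powr - \<theta>\<close>, so replacing \<open>\<alpha> x\<close> by \<open>\<alpha> (p i)\<close> changes \<open>w x powr \<alpha> x\<close> by a
  bounded factor only (\<open>powr_comparable_exponents\<close>). A small cube close to \<open>p i\<close> therefore inherits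
  the \<open>A1\<close> bound of the constant power \<open>w powr \<alpha> (p i)\<close>. A small cube away from all singularities is
  trivial because the weight is bounded there (\<open>ess_bounded_off_singularities\<close>) and at least \<open>1\<close>, and
  large cubes are trivial because the weight is integrable and at least \<open>1\<close> (\<open>A1_of_small_cubes\<close>).

  The self-improvement is where the work lies. A Vitali covering by cubes of nearly maximal size with
  large average gives the inequality \<open>mass_of_superlevel_set\<close>, which bounds the mass of \<open>w\<close> above a
  level by that level times the volume of a slightly lower superlevel set; the \<open>A1\<close> condition enters
  by making \<open>w\<close> large almost everywhere on a cube with large average. Summing over dyadic levels with
  weights \<open>t powr e\<close> and absorbing the result for small \<open>e\<close> gives the reverse Hoelder inequality
  \<open>reverse_holder_bounded\<close> for truncations, with constants independent of the truncation.
\<close>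

section \<open>Coverings and cubes\<close>

text \<open>
  The counting step of every covering argument below: overlapping sets \<open>X j\<close> whose \<open>M\<close>-mass
  is controlled by disjoint witnesses \<open>A j\<close> inside \<open>T\<close> have total mass controlled by that of \<open>T\<close>.
  Subadditivity is used for \<open>M\<close> and additivity for \<open>N\<close>.
\<close>
lemma emeasure_UN_le_transfer:
  assumes J: "countable J"
    and X: "\<And>j. j \<in> J \<Longrightarrow> X j \<in> sets M"
    and A: "\<And>j. j \<in> J \<Longrightarrow> A j \<in> sets N"
    and disj: "disjoint_family_on A J"
    and le: "\<And>j. j \<in> J \<Longrightarrow> emeasure M (X j) \<le> c * emeasure N (A j)"
    and T: "(\<Union>j\<in>J. A j) \<subseteq> T" "T \<in> sets N"
  shows "emeasure M (\<Union>j\<in>J. X j) \<le> c * emeasure N T"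
proof -
  define e where "e = to_nat_on J"
  have inj: "inj_on e J" unfolding e_def using J by (rule inj_on_to_nat_on)
  define X' where "X' = (\<lambda>n. if n \<in> e ` J then X (inv_into J e n) else {})"
  define A' where "A' = (\<lambda>n. if n \<in> e ` J then A (inv_into J e n) else {})"
  have X': "range X' \<subseteq> sets M" using X by (auto simp: X'_def inj)
  have A': "range A' \<subseteq> sets N" using A by (auto simp: A'_def inj)
  have d: "disjoint_family A'"
    unfolding disjoint_family_on_def
  proof (intro ballI impI)
    fix i k :: nat assume ik: "i \<noteq> k"
    show "A' i \<inter> A' k = {}"
    proof (cases "i \<in> e ` J \<and> k \<in> e ` J")
      case True
      then have "inv_into J e i \<in> J" "inv_into J e k \<in> J" "inv_into J e i \<noteq> inv_into J e k"
        using ik by (auto intro: inv_into_into simp: inj inv_into_f_f)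
      then show ?thesis using disj True by (auto simp: A'_def disjoint_family_on_def)
    qed (auto simp: A'_def)
  qed
  have UX: "(\<Union>j\<in>J. X j) = (\<Union>n. X' n)"
    using inj by (auto simp: X'_def)
  have UA: "(\<Union>j\<in>J. A j) = (\<Union>n. A' n)"
    using inj by (auto simp: A'_def)
  have "emeasure M (\<Union>n. X' n) \<le> (\<Sum>n. emeasure M (X' n))"
    by (rule emeasure_subadditive_countably[OF X'])
  also have "\<dots> \<le> (\<Sum>n. c * emeasure N (A' n))"
    using le inj by (intro suminf_le) (auto simp: X'_def A'_def)
  also have "\<dots> = c * (\<Sum>n. emeasure N (A' n))" by (rule ennreal_suminf_cmult)
  also have "\<dots> = c * emeasure N (\<Union>n. A' n)"
    using suminf_emeasure[OF A' d] by simp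
  also have "\<dots> \<le> c * emeasure N T"
    using T UA by (intro mult_left_mono emeasure_mono) auto
  finally show ?thesis by (simp add: UX)
qed

lemma emeasure_lebesgue_box_equal_sides:
  fixes u :: "'a::euclidean_space"
  assumes "l \<ge> 0"
  shows "emeasure lebesgue (box u (u + l *\<^sub>R One)) = ennreal (l ^ DIM('a))"
proof -
  have "emeasure lebesgue (box u (u + l *\<^sub>R One)) = emeasure lborel (box u (u + l *\<^sub>R One))"
    by simp
  also have "\<dots> = (\<Prod>b\<in>(Basis::'a set). (u + l *\<^sub>R One - u) \<bullet> b)"
    using assms by (intro emeasure_lborel_box) (auto simp: inner_add_left)
  also have "(\<Prod>b\<in>(Basis::'a set). (u + l *\<^sub>R One - u) \<bullet> b) = l ^ DIM('a)"
    by (simp add: inner_add_left)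
  finally show ?thesis .
qed

lemma mem_cube: "y \<in> cube x l \<longleftrightarrow> (\<forall>i\<in>Basis. \<bar>y \<bullet> i - x \<bullet> i\<bar> < l / 2)"
proof -
  have "(x - (l/2) *\<^sub>R One) \<bullet> i < y \<bullet> i \<and> y \<bullet> i < (x + (l/2) *\<^sub>R One) \<bullet> i \<longleftrightarrow> \<bar>y \<bullet> i - x \<bullet> i\<bar> < l / 2"
    if "i \<in> Basis" for i
    using that by (simp add: inner_add_left inner_diff_left) argo
  then show ?thesis unfolding cube_def mem_box by blast
qed

lemma emeasure_cube:
  fixes x :: "'a::euclidean_space"
  assumes "l \<ge> 0"
  shows "emeasure lebesgue (cube x l) = ennreal (l ^ DIM('a))"
proof -
  have "cube x l = box (x - (l/2) *\<^sub>R One) (x - (l/2) *\<^sub>R One + l *\<^sub>R One)"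
  proof -
    have eq: "x + (l/2) *\<^sub>R v = x - (l/2) *\<^sub>R v + l *\<^sub>R v" for v :: 'a
    proof -
      have "l *\<^sub>R v = (l/2) *\<^sub>R v + (l/2) *\<^sub>R v" by (simp flip: scaleR_add_left)
      then show ?thesis by (simp add: algebra_simps)
    qed
    show ?thesis unfolding cube_def using eq[of One] by argo
  qed
  then show ?thesis using emeasure_lebesgue_box_equal_sides[OF assms] by metis
qed

lemma open_cube [simp]: "open (cube x l)" unfolding cube_def by (rule open_box)

lemma sets_cube [simp, measurable]: "cube x l \<in> sets lebesgue"
  by (simp add: cube_def)

lemma cube_mono: "l \<le> l' \<Longrightarrow> cube x l \<subseteq> cube x l'"
  by (auto simp: mem_cube) (meson dual_order.strict_trans1 divide_right_mono zero_le_numeral)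

lemma ball_subset_cube:
  assumes "d \<le> l / 2" shows "ball x d \<subseteq> cube x l"
proof
  fix y assume "y \<in> ball x d"
  then have "norm (y - x) < l/2" using assms by (simp add: dist_norm norm_minus_commute)
  then show "y \<in> cube x l" unfolding mem_cube
    by (metis Basis_le_norm inner_diff_left le_less_trans)
qed

lemma cube_subset_cball:
  fixes x :: "'a::euclidean_space" and l :: real
  shows "cube x l \<subseteq> cball x (DIM('a) * l / 2)"
proof
  fix y assume y: "y \<in> cube x l"
  have "norm (y - x) \<le> (\<Sum>i\<in>Basis. \<bar>(y - x) \<bullet> i\<bar>)" by (rule norm_le_l1)
  also have "\<dots> \<le> (\<Sum>i\<in>(Basis::'a set). l/2)" using y
    by (intro sum_mono) (auto simp: mem_cube inner_diff_left less_imp_le)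
  finally show "y \<in> cball x (DIM('a) * l / 2)" by (simp add: dist_norm norm_minus_commute)
qed

section \<open>Large values force large averages\<close>

text \<open>
  One half of the Lebesgue differentiation theorem, with a dimensional loss that does no harm here:
  a function cannot be large on a set of positive measure all of whose points only see small
  averages. The set is covered by dyadic cells lying in an open set of almost the same measure. A
  cell of side \<open>h\<close> containing \<open>x \<in> N\<close> lies, up to its boundary, in the cube of side \<open>2 * h\<close> centred
  at \<open>x\<close>, which is where the factor \<open>2 ^ DIM('a)\<close> comes from; the remaining factor \<open>2\<close> in the
  hypothesis \<open>big\<close> makes the two estimates for the mass of \<open>N\<close> incompatible.
\<close>
lemma null_set_of_small_averages:
  fixes f :: "'a::euclidean_space \<Rightarrow> real"
  assumes f: "f \<in> borel_measurable lebesgue" and lam: "t > 0"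
    and N: "N \<in> sets lebesgue" "bounded N"
    and avg: "\<And>y l. y \<in> N \<Longrightarrow> l > 0 \<Longrightarrow>
         (\<integral>\<^sup>+x\<in>cube y l. ennreal (f x) \<partial>lebesgue) \<le> ennreal (t * l ^ DIM('a))"
    and big: "\<And>x. x \<in> N \<Longrightarrow> f x > 2 ^ (DIM('a) + 1) * t"
  shows "N \<in> null_sets lebesgue"
proof -
  let ?n = "DIM('a)"
  define \<nu> where "\<nu> = density lebesgue (\<lambda>x. ennreal (f x))"
  have \<nu>: "emeasure \<nu> A = (\<integral>\<^sup>+x\<in>A. ennreal (f x) \<partial>lebesgue)" if "A \<in> sets lebesgue" for A
    unfolding \<nu>_def using f that by (subst emeasure_density) auto
  have fin: "emeasure lebesgue N < \<infinity>" using emeasure_bounded_finite[OF N(2)] N(1)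
    by (metis bounded_set_imp_lmeasurable[OF N(2)] fmeasurableD2 infinity_ennreal_def less_top)
  define \<mu> where "\<mu> = measure lebesgue N"
  have \<mu>: "emeasure lebesgue N = ennreal \<mu>" "\<mu> \<ge> 0"
    unfolding \<mu>_def using fin by (auto simp: emeasure_eq_ennreal_measure)
  obtain k where k: "k > 0" "N \<subseteq> cbox (- k *\<^sub>R One) (k *\<^sub>R One)"
  proof -
    obtain k where k: "k > 0" "\<And>x. x \<in> N \<Longrightarrow> norm x < k"
      using N(2) unfolding bounded_pos_less by blast
    have "\<And>x i. \<lbrakk>x \<in> N; i \<in> Basis\<rbrakk> \<Longrightarrow> - k \<le> x \<bullet> i \<and> x \<bullet> i \<le> k"
      using k by (meson Basis_le_norm abs_le_iff less_le_trans less_imp_le order_trans minus_le_iff)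
    then have "N \<subseteq> cbox (- k *\<^sub>R One) (k *\<^sub>R One)" by (auto simp: mem_box)
    then show thesis using k(1) that[of k] by blast
  qed
  have main: "2 ^ ?n * t * \<mu> \<le> 2 ^ ?n * t * e" if e: "e > 0" for e
  proof -
    obtain T where T: "open T" "N \<subseteq> T" "(T - N) \<in> lmeasurable" "emeasure lebesgue (T - N) < ennreal e"
      using sets_lebesgue_outer_open[OF N(1) e] by blast
    \<comment> \<open>A gauge that forces every cell, being tagged by a point of N, to lie inside T.\<close>
    define g where "g = (\<lambda>x. if x \<in> T then T else UNIV)"
    have ga: "gauge g" unfolding gauge_def g_def using T(1) by auto
    have ne: "box (- k *\<^sub>R One) (k *\<^sub>R One :: 'a) \<noteq> {}"
      using k(1) by (auto simp: box_ne_empty)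
    obtain D where D: "countable D" "\<Union>D \<subseteq> cbox (- k *\<^sub>R One) (k *\<^sub>R One)"
      "\<And>K. K \<in> D \<Longrightarrow> interior K \<noteq> {} \<and> (\<exists>c d. K = cbox c d)"
      "pairwise (\<lambda>A B. interior A \<inter> interior B = {}) D"
      "\<And>K. K \<in> D \<Longrightarrow> \<exists>x \<in> N \<inter> K. K \<subseteq> g x"
      "\<And>u v. cbox u v \<in> D \<Longrightarrow> \<exists>n. \<forall>i \<in> Basis. v \<bullet> i - u \<bullet> i = ((k *\<^sub>R One) \<bullet> i - (- k *\<^sub>R One) \<bullet> i) / 2^n"
      "N \<subseteq> \<Union>D"
      using that by (rule covering_lemma[OF k(2) ne ga])
    have "emeasure \<nu> (\<Union>K\<in>D. K) \<le> ennreal (2 ^ ?n * t) * emeasure lebesgue T"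
    proof (rule emeasure_UN_le_transfer[where A = interior])
      show "countable D" by fact
      show "K \<in> sets \<nu>" if "K \<in> D" for K using D(3)[OF that] by (auto simp: \<nu>_def)
      show "interior K \<in> sets lebesgue" for K :: "'a set" by simp
      show "disjoint_family_on interior D" using D(4)
        by (auto simp: disjoint_family_on_def pairwise_def)
      show "(\<Union>K\<in>D. interior K) \<subseteq> T"
        using D(5) T(2) interior_subset unfolding g_def by (fastforce split: if_splits)
      show "T \<in> sets lebesgue" using T(1) by auto
      fix K assume K: "K \<in> D"
      obtain u v where uv: "K = cbox u v" using D(3) K by blast
      obtain j where j: "\<forall>i \<in> Basis. v \<bullet> i - u \<bullet> i = 2 * k / 2^j"
        using D(6)[of u v] K uv by auto
      define h where "h = 2 * k / 2 ^ j"
      have h: "h > 0" using k by (simp add: h_def)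
      have v: "v = u + h *\<^sub>R One"
      proof (rule euclidean_eqI)
        fix i :: 'a assume i: "i \<in> Basis"
        then have "v \<bullet> i - u \<bullet> i = h" using j by (simp add: h_def)
        then show "v \<bullet> i = (u + h *\<^sub>R One) \<bullet> i" using i by (simp add: inner_add_left)
      qed
      obtain x where x: "x \<in> N" "x \<in> K" using D(5) K by blast
      have "AE y in lebesgue. y \<in> K \<longrightarrow> y \<in> cube x (2 * h)"
      proof -
        have "interior K \<subseteq> cube x (2*h)"
          unfolding mem_cube subset_eq
        proof safe
          fix y and i :: 'a assume y: "y \<in> interior K" and i: "i \<in> Basis"
          have "u \<bullet> i < y \<bullet> i \<and> y \<bullet> i < u \<bullet> i + h" "u \<bullet> i \<le> x \<bullet> i \<and> x \<bullet> i \<le> u \<bullet> i + h"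
            using x(2) y i unfolding uv v interior_cbox mem_box by (auto simp: inner_add_left)
          then show "\<bar>y \<bullet> i - x \<bullet> i\<bar> < 2 * h / 2" using h by (simp add: abs_less_iff)
        qed
        moreover have "frontier K \<in> null_sets lebesgue"
          unfolding uv using negligible_convex_frontier[of "cbox u v"] by (simp add: negligible_iff_null_sets)
        then have "AE y in lebesgue. y \<notin> frontier K" by (rule AE_not_in)
        ultimately show ?thesis using closure_subset[of K]
          by (auto simp: frontier_def elim!: eventually_mono)
      qed
      then have "emeasure \<nu> K \<le> (\<integral>\<^sup>+y\<in>cube x (2*h). ennreal (f y) \<partial>lebesgue)"
        using uv by (subst \<nu>) (auto intro!: nn_integral_mono_AE elim!: eventually_mono simp: indicator_def)
      also have "\<dots> \<le> ennreal (t * (2 * h) ^ ?n)" by (rule avg[OF x(1)]) (use h in simp)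
      also have "\<dots> = ennreal (2 ^ ?n * t) * ennreal (h ^ ?n)"
        using lam h by (subst ennreal_mult[symmetric]) (auto simp: power_mult_distrib algebra_simps)
      also have "ennreal (h ^ ?n) = emeasure lebesgue (interior K)"
        unfolding uv interior_cbox v using emeasure_lebesgue_box_equal_sides[of h u] h by simp
      finally show "emeasure \<nu> K \<le> ennreal (2 ^ ?n * t) * emeasure lebesgue (interior K)" .
    qed
    moreover have "ennreal (2 ^ (?n + 1) * t) * emeasure lebesgue N \<le> emeasure \<nu> (\<Union>K\<in>D. K)"
    proof -
      have "ennreal (2 ^ (?n + 1) * t) * emeasure lebesgue N
           = (\<integral>\<^sup>+x. ennreal (2 ^ (?n + 1) * t) * indicator N x \<partial>lebesgue)"
        using N(1) by (simp add: nn_integral_cmult_indicator)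
      also have "\<dots> \<le> (\<integral>\<^sup>+x\<in>N. ennreal (f x) \<partial>lebesgue)"
      proof (rule nn_integral_mono)
        fix x :: 'a
        show "ennreal (2 ^ (?n + 1) * t) * indicator N x \<le> ennreal (f x) * indicator N x"
        proof (cases "x \<in> N")
          case True
          then show ?thesis using ennreal_leI[OF less_imp_le[OF big[OF True]]] by (simp del: power_Suc)
        qed simp
      qed
      also have "\<dots> = emeasure \<nu> N" using N(1) by (simp add: \<nu>)
      also have "\<dots> \<le> emeasure \<nu> (\<Union>K\<in>D. K)"
      proof (rule emeasure_mono)
        show "N \<subseteq> (\<Union>K\<in>D. K)" using D(7) by auto
        have "(\<Union>K\<in>D. K) \<in> sets lebesgue" using D(1,3)
          by (intro sets.countable_UN' ) (auto, metis lmeasurable_cbox fmeasurableD)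
        then show "(\<Union>K\<in>D. K) \<in> sets \<nu>" by (simp add: \<nu>_def)
      qed
      finally show ?thesis .
    qed
    moreover have "emeasure lebesgue T \<le> ennreal (\<mu> + e)"
    proof -
      have "emeasure lebesgue T \<le> emeasure lebesgue N + emeasure lebesgue (T - N)"
        using emeasure_subadditive[of N lebesgue "T - N"] N(1) T by (simp add: Un_absorb1 fmeasurableD)
      also have "\<dots> \<le> ennreal \<mu> + ennreal e" using T(4) \<mu> by (intro add_mono) auto
      finally show ?thesis using \<mu> e by simp
    qed
    ultimately have "ennreal (2 ^ (?n + 1) * t) * ennreal \<mu> \<le> ennreal (2 ^ ?n * t) * ennreal (\<mu> + e)"
      using \<mu> by (metis (no_types, lifting) mult_left_mono order_trans zero_le)
    then have "2 ^ (?n + 1) * t * \<mu> \<le> 2 ^ ?n * t * (\<mu> + e)"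
      using \<mu> lam e by (simp add: ennreal_mult[symmetric] del: power_Suc power_add ennreal_plus)
    then show ?thesis by (simp add: algebra_simps)
  qed
  have "\<mu> \<le> e" if "e > 0" for e using main[OF that] lam by simp
  then have "\<mu> \<le> 0" by (rule field_le_epsilon[of _ 0, simplified])
  then have "emeasure lebesgue N = 0" using \<mu> by simp
  then show ?thesis using N(1) by auto
qed

section \<open>The good-\<open>\<lambda>\<close> inequality\<close>

text \<open>
  A cube centred in a box, and no wider than the box, keeps at least the fraction \<open>2 powr - n\<close> of
  its volume inside: in each coordinate, half of its side fits on one side of the centre.
\<close>
lemma corner_subset_cube_Int_box:
  fixes u v y :: "'a::euclidean_space"
  assumes side: "\<And>i. i \<in> Basis \<Longrightarrow> v \<bullet> i - u \<bullet> i \<ge> s" and y: "y \<in> box u v" and l: "0 < l" "l \<le> s"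
  obtains c where "box c (c + (l/2) *\<^sub>R One) \<subseteq> cube y l \<inter> box u v"
proof
  define c where "c = (\<Sum>i\<in>Basis. max (u \<bullet> i) (y \<bullet> i - l/2) *\<^sub>R i)"
  have c: "c \<bullet> i = max (u \<bullet> i) (y \<bullet> i - l/2)" if "i \<in> Basis" for i
    unfolding c_def using that by simp
  show "box c (c + (l/2) *\<^sub>R One) \<subseteq> cube y l \<inter> box u v"
  proof
    fix z assume z: "z \<in> box c (c + (l/2) *\<^sub>R One)"
    have "\<bar>z \<bullet> i - y \<bullet> i\<bar> < l / 2 \<and> u \<bullet> i < z \<bullet> i \<and> z \<bullet> i < v \<bullet> i" if i: "i \<in> Basis" for i
    proof -
      have z1: "c \<bullet> i < z \<bullet> i" "z \<bullet> i < c \<bullet> i + l / 2"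
        using z i by (auto simp: mem_box inner_add_left)
      have y1: "u \<bullet> i < y \<bullet> i" "y \<bullet> i < v \<bullet> i" using y i by (auto simp: mem_box)
      show ?thesis using z1 y1 side[OF i] l unfolding c[OF i] by (simp add: max_def split: if_splits; argo)
    qed
    then show "z \<in> cube y l \<inter> box u v" by (auto simp: mem_cube mem_box)
  qed
qed

text \<open>
  A stopping scale up to a factor \<open>2\<close>. Asking for this instead of a supremum makes it
  irrelevant how averages depend on the side of the cube.
\<close>
lemma maximal_scale:
  fixes F :: "real \<Rightarrow> bool"
  assumes "F l" "l > 0" and bd: "\<And>l. F l \<Longrightarrow> l \<le> s"
  obtains l' where "l \<le> l'" "F l'" "\<And>k. k \<ge> 2 * l' \<Longrightarrow> \<not> F k"
proof -
  have "\<exists>l'\<ge>l. F l' \<and> (\<forall>k\<ge>2 * l'. \<not> F k)"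
  proof (rule ccontr)
    assume "\<not> ?thesis"
    then have H: "\<And>l'. l' \<ge> l \<Longrightarrow> F l' \<Longrightarrow> \<exists>k\<ge>2 * l'. F k" by blast
    have "\<exists>k\<ge>2 ^ j * l. F k" for j :: nat
    proof (induction j)
      case 0 then show ?case using assms(1) by auto
    next
      case (Suc j)
      then obtain k where k: "k \<ge> 2 ^ j * l" "F k" by blast
      have "1 * l \<le> 2 ^ j * l" using assms(2) by (intro mult_right_mono) auto
      with k H[of k] obtain k' where "k' \<ge> 2 * k" "F k'" by auto
      then show ?case using k by (intro exI[of _ k']) auto
    qed
    then have "2 ^ j * l \<le> s" for j :: nat using bd by (meson order_trans)
    moreover obtain j :: nat where "s / l < 2 ^ j" using real_arch_pow[of 2 "s / l"] by auto
    ultimately show False using assms(2) by (simp add: field_simps) (meson not_le)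
  qed
  then show thesis using that by blast
qed

text \<open>
  The good-\<open>\<lambda>\<close> inequality behind the reverse Hoelder property. Call a cube centred in \<open>P\<close> heavy if
  the average of \<open>f\<close> over it exceeds \<open>t\<close>. By \<open>null_set_of_small_averages\<close> almost all of
  \<open>{f > 2 ^ (n + 1) * t}\<close> is covered by heavy cubes, and by \<open>total\<close> no heavy cube has side above \<open>s\<close>.
  Enlarge each heavy cube to a nearly maximal one and choose a disjoint Vitali subfamily: the dilated
  cubes still cover, their averages are at most \<open>t\<close> by maximality, and the \<open>A1\<close> condition says that
  \<open>f > t / C\<close> almost everywhere on \<open>P\<close> inside a heavy cube. So the mass is paid for by the volume of
  the lower superlevel set.
\<close>
lemma mass_of_superlevel_set:
  fixes f :: "'a::euclidean_space \<Rightarrow> real" and u v :: 'a and s t C :: real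
  defines "P \<equiv> box u v"
  assumes f: "f \<in> borel_measurable lebesgue" and off: "\<And>x. x \<notin> P \<Longrightarrow> f x = 0"
    and side: "\<And>i. i \<in> Basis \<Longrightarrow> v \<bullet> i - u \<bullet> i \<ge> s" and s: "s > 0" and C: "C > 0" and t: "t > 0"
    and A1: "\<And>z l. z \<in> P \<Longrightarrow> l > 0 \<Longrightarrow> AE x in lebesgue. x \<in> cube z l \<inter> P \<longrightarrow>
          (\<integral>\<^sup>+y\<in>cube z l. ennreal (f y) \<partial>lebesgue) \<le> ennreal (C * f x * l ^ DIM('a))"
    and total: "(\<integral>\<^sup>+y. ennreal (f y) \<partial>lebesgue) \<le> ennreal (t * s ^ DIM('a))"
  shows "(\<integral>\<^sup>+y\<in>{y. f y > 2 ^ (DIM('a) + 1) * t}. ennreal (f y) \<partial>lebesgue)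
      \<le> ennreal ((10 * real DIM('a)) ^ DIM('a) * t) * emeasure lebesgue {y \<in> P. f y > t / C}"
proof -
  let ?n = "DIM('a)"
  define \<nu> where "\<nu> = density lebesgue (\<lambda>x. ennreal (f x))"
  have sets_\<nu>: "sets \<nu> = sets lebesgue" by (simp add: \<nu>_def)
  have \<nu>: "emeasure \<nu> A = (\<integral>\<^sup>+x\<in>A. ennreal (f x) \<partial>lebesgue)" if "A \<in> sets lebesgue" for A
    unfolding \<nu>_def using f that by (subst emeasure_density) auto
  have P: "P \<in> sets lebesgue" by (simp add: P_def)
  define E where "E = {y. f y > 2 ^ (?n + 1) * t}"
  have "{y \<in> space lebesgue. f y > 2 ^ (?n + 1) * t} \<in> sets lebesgue" using f by measurable
  then have E: "E \<in> sets lebesgue" by (simp add: E_def)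
  have EP: "E \<subseteq> P"
  proof
    fix x assume "x \<in> E"
    then have "f x > 2 ^ (?n + 1) * t" by (simp add: E_def)
    then have "f x > 0" using t by (metis less_trans mult_pos_pos zero_less_numeral zero_less_power)
    then show "x \<in> P" using off by force
  qed
  define H where "H = {y \<in> P. f y > t / C}"
  have "{y \<in> space lebesgue. f y > t / C} \<in> sets lebesgue" using f by measurable
  then have H: "H \<in> sets lebesgue" using P by (auto simp: H_def Collect_conj_eq)
  \<comment> \<open>The family G of all heavy cubes is open, so the uncovered part of E is measurable without
    any regularity of the averages in the centre of the cube.\<close>
  define heavy where "heavy = (\<lambda>y l. l > 0 \<and> emeasure \<nu> (cube y l) > ennreal (t * l ^ ?n))"
  have small: "l \<le> s" if "heavy y l" for y l
  proof (rule ccontr)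
    assume "\<not> l \<le> s"
    then have "s ^ ?n \<le> l ^ ?n" using s by (intro power_mono) auto
    then have "ennreal (t * s ^ ?n) \<le> ennreal (t * l ^ ?n)" using t by (intro ennreal_leI) auto
    moreover have "emeasure \<nu> (cube y l) \<le> (\<integral>\<^sup>+y. ennreal (f y) \<partial>lebesgue)"
      by (subst \<nu>) (auto intro!: nn_integral_mono simp: indicator_def)
    ultimately show False using that total unfolding heavy_def
      by (meson not_le order_trans)
  qed
  define K :: "('a \<times> real) set" where "K = {(y, l). y \<in> P \<and> heavy y l \<and> (\<forall>k\<ge>2 * l. \<not> heavy y k)}"
  define G where "G = (\<Union>(y, l)\<in>{(y, l). y \<in> P \<and> heavy y l}. cube y l)"
  have "open G" unfolding G_def by auto
  have "E - G \<in> null_sets lebesgue"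
  proof (rule null_set_of_small_averages[OF f t])
    show "E - G \<in> sets lebesgue" using E \<open>open G\<close> by auto
    show "bounded (E - G)" using EP bounded_box[of u v] unfolding P_def by (meson Diff_subset bounded_subset)
    show "f x > 2 ^ (?n + 1) * t" if "x \<in> E - G" for x using that by (simp add: E_def)
    fix y l assume y: "y \<in> E - G" and l: "(l::real) > 0"
    have "\<not> heavy y l"
    proof
      assume h: "heavy y l"
      then have "y \<in> G" using y EP l unfolding G_def
        by (auto intro!: exI[of _ y] exI[of _ l] simp: mem_cube)
      then show False using y by simp
    qed
    then show "(\<integral>\<^sup>+x\<in>cube y l. ennreal (f x) \<partial>lebesgue) \<le> ennreal (t * l ^ ?n)"
      using l by (simp add: heavy_def \<nu> not_less)
  qed
  \<comment> \<open>The covering lemma speaks about balls; this is the radius of a ball containing the cube.\<close>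
  define rad :: "'a \<times> real \<Rightarrow> real" where "rad q = ?n * snd q / 2" for q :: "'a \<times> real"
  have rad: "0 < rad q \<and> rad q \<le> ?n * s / 2" if "q \<in> K" for q :: "'a \<times> real"
    using that small unfolding K_def heavy_def rad_def by (auto simp: mult_le_cancel_left)
  obtain J where J: "countable J" "J \<subseteq> K"
     "pairwise (\<lambda>i j. disjnt (cball (fst i) (rad i)) (cball (fst j) (rad j))) J"
     "\<And>i. i \<in> K \<Longrightarrow> \<exists>j. j \<in> J \<and> \<not> disjnt (cball (fst i) (rad i)) (cball (fst j) (rad j)) \<and>
        cball (fst i) (rad i) \<subseteq> ball (fst j) (5 * rad j)"
    by (rule Vitali_covering_lemma_cballs_balls[of K rad "?n * s / 2" fst], erule rad, rule that)
  have JK: "fst j \<in> P" "heavy (fst j) (snd j)" "snd j > 0" "\<And>k. k \<ge> 2 * snd j \<Longrightarrow> \<not> heavy (fst j) k" if "j \<in> J" for j :: "'a \<times> real"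
    using J(2) that unfolding K_def heavy_def by auto
  have n1: "real ?n \<ge> 1" by (metis DIM_positive One_nat_def Suc_leI of_nat_1 of_nat_mono)
  have G_cover: "G \<subseteq> (\<Union>j\<in>J. cube (fst j) (5 * real ?n * snd j))"
  proof
    fix x assume "x \<in> G"
    then obtain y l where yl: "y \<in> P" "heavy y l" "x \<in> cube y l" unfolding G_def by auto
    then obtain l' where l': "l \<le> l'" "heavy y l'" "\<And>k. k \<ge> 2 * l' \<Longrightarrow> \<not> heavy y k"
      using maximal_scale[of "heavy y" l s] small unfolding heavy_def by metis
    then have "(y, l') \<in> K" using yl by (auto simp: K_def)
    then obtain j where j: "j \<in> J" "cball y (?n * l' / 2) \<subseteq> ball (fst j) (5 * rad j)"
      using J(4)[of "(y, l')"] by (auto simp: rad_def)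
    have "x \<in> cball y (?n * l' / 2)" using yl(3) l'(1) cube_mono cube_subset_cball by blast
    then have "x \<in> cube (fst j) (5 * real ?n * snd j)"
      using j(2) ball_subset_cube[of "5 * rad j" "5 * real ?n * snd j" "fst j"] by (auto simp: rad_def)
    then show "x \<in> (\<Union>j\<in>J. cube (fst j) (5 * real ?n * snd j))" using j(1) by blast
  qed
  have UJ: "(\<Union>j\<in>J. cube (fst j) (5 * real ?n * snd j)) \<in> sets lebesgue"
    by (intro sets.countable_UN'[OF J(1)]) auto
  have "emeasure \<nu> (\<Union>j\<in>J. cube (fst j) (5 * real ?n * snd j)) \<le> ennreal ((10 * real ?n) ^ ?n * t) * emeasure lebesgue H"
  proof (rule emeasure_UN_le_transfer[where A = "\<lambda>j. cube (fst j) (snd j) \<inter> H"])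
    show "countable J" by fact
    show "disjoint_family_on (\<lambda>j. cube (fst j) (snd j) \<inter> H) J"
      unfolding disjoint_family_on_def
    proof (intro ballI impI)
      fix i j assume "i \<in> J" "j \<in> J" "i \<noteq> j"
      then have "disjnt (cball (fst i) (rad i)) (cball (fst j) (rad j))"
        using J(3) by (auto simp: pairwise_def)
      then show "cube (fst i) (snd i) \<inter> H \<inter> (cube (fst j) (snd j) \<inter> H) = {}"
        using cube_subset_cball[of "fst i" "snd i"] cube_subset_cball[of "fst j" "snd j"] unfolding disjnt_def rad_def by blast
    qed
    fix j assume j: "j \<in> J"
    note jk = JK[OF j]
    have ae: "AE x in lebesgue. x \<in> cube (fst j) (snd j) \<inter> P \<longrightarrow> x \<in> cube (fst j) (snd j) \<inter> H"
      using A1[OF jk(1) jk(3)]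
    proof (rule eventually_mono, intro impI)
      fix x assume a: "x \<in> cube (fst j) (snd j) \<inter> P \<longrightarrow>
          (\<integral>\<^sup>+y\<in>cube (fst j) (snd j). ennreal (f y) \<partial>lebesgue) \<le> ennreal (C * f x * snd j ^ ?n)"
        and x: "x \<in> cube (fst j) (snd j) \<inter> P"
      have "ennreal (t * snd j ^ ?n) < ennreal (C * f x * snd j ^ ?n)"
        using jk(2) a x unfolding heavy_def by (auto simp: \<nu>)
      then have "t * snd j ^ ?n < C * f x * snd j ^ ?n"
        using t jk(3) by (subst (asm) ennreal_less_iff) auto
      then have "t < C * f x" using jk(3) by (simp add: mult_less_cancel_right)
      then show "x \<in> cube (fst j) (snd j) \<inter> H" using x C by (auto simp: H_def field_simps)
    qed
    obtain c where c: "box c (c + (snd j/2) *\<^sub>R One) \<subseteq> cube (fst j) (snd j) \<inter> P"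
      using corner_subset_cube_Int_box[OF side _ jk(3) small[OF jk(2)]] jk(1) unfolding P_def by blast
    have "ennreal ((snd j / 2) ^ ?n) = emeasure lebesgue (box c (c + (snd j/2) *\<^sub>R One))"
      using emeasure_lebesgue_box_equal_sides[of "snd j / 2" c] jk(3) by simp
    also have "\<dots> \<le> emeasure lebesgue (cube (fst j) (snd j) \<inter> P)"
      using P by (intro emeasure_mono c) auto
    also have "\<dots> \<le> emeasure lebesgue (cube (fst j) (snd j) \<inter> H)"
      using ae H by (intro emeasure_mono_AE) auto
    finally have vol: "ennreal ((snd j / 2) ^ ?n) \<le> emeasure lebesgue (cube (fst j) (snd j) \<inter> H)" .
    have "2 * snd j \<le> 5 * real ?n * snd j" using n1 jk(3) by (intro mult_right_mono) linarith+
    then have "\<not> heavy (fst j) (5 * real ?n * snd j)" by (rule jk(4))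
    then have "emeasure \<nu> (cube (fst j) (5 * real ?n * snd j)) \<le> ennreal (t * (5 * real ?n * snd j) ^ ?n)"
      using jk(3) by (auto simp: heavy_def not_less)
    also have "t * (5 * real ?n * snd j) ^ ?n = (10 * real ?n) ^ ?n * t * (snd j / 2) ^ ?n"
    proof -
      have "5 * real ?n * snd j = 10 * real ?n * (snd j / 2)" by simp
      then have "(5 * real ?n * snd j) ^ ?n = (10 * real ?n) ^ ?n * (snd j / 2) ^ ?n"
        by (simp only: power_mult_distrib)
      then show ?thesis by (simp only: mult_ac)
    qed
    also have "ennreal \<dots> = ennreal ((10 * real ?n) ^ ?n * t) * ennreal ((snd j / 2) ^ ?n)"
      using t jk(3) by (intro ennreal_mult) auto
    also have "\<dots> \<le> ennreal ((10 * real ?n) ^ ?n * t) * emeasure lebesgue (cube (fst j) (snd j) \<inter> H)"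
      using vol by (rule mult_left_mono) simp
    finally show "emeasure \<nu> (cube (fst j) (5 * real ?n * snd j)) \<le> ennreal ((10 * real ?n) ^ ?n * t) * emeasure lebesgue (cube (fst j) (snd j) \<inter> H)" .
  qed (use H in \<open>auto simp: sets_\<nu>\<close>)
  moreover have "emeasure \<nu> E \<le> emeasure \<nu> (\<Union>j\<in>J. cube (fst j) (5 * real ?n * snd j))"
  proof (rule emeasure_mono_AE)
    have "AE x in lebesgue. x \<notin> E - G" using \<open>E - G \<in> null_sets lebesgue\<close> by (rule AE_not_in)
    then have "AE x in \<nu>. x \<notin> E - G" unfolding \<nu>_def using f by (subst AE_density) auto
    then show "AE x in \<nu>. x \<in> E \<longrightarrow> x \<in> (\<Union>j\<in>J. cube (fst j) (5 * real ?n * snd j))"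
      by (rule eventually_mono) (use G_cover in blast)
  qed (use UJ in \<open>simp add: sets_\<nu>\<close>)
  ultimately have "emeasure \<nu> E \<le> ennreal ((10 * real ?n) ^ ?n * t) * emeasure lebesgue H" by (rule order_trans[rotated])
  then show ?thesis using E by (simp add: \<nu> E_def H_def)
qed

section \<open>The reverse Hoelder inequality for bounded functions\<close>

text \<open>
  Discrete layer-cake formula from above: the powers \<open>(T * 2 ^ k) powr e\<close> telescope, so a value
  \<open>a\<close> in a dyadic layer is bounded by the jumps at the thresholds below it.
\<close>
lemma powr_le_dyadic_layers:
  fixes a T e :: real
  assumes "T > 0" "e > 0" "0 \<le> a" "a \<le> T * 2 ^ N"
  shows "a powr e \<le> T powr e + (\<Sum>k<N. (2 powr e - 1) * (T * 2 ^ k) powr e * of_bool (a > T * 2 ^ k))"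
  using assms(4)
proof (induction N)
  case 0
  then show ?case using assms by (simp add: powr_mono2)
next
  case (Suc N)
  let ?S = "\<lambda>n. \<Sum>k<n. (2 powr e - 1) * (T * 2 ^ k) powr e * of_bool (a > T * 2 ^ k)"
  show ?case
  proof (cases "a \<le> T * 2 ^ N")
    case True
    then show ?thesis using Suc.IH by simp
  next
    case False
    have tel: "(T * 2 ^ n) powr e = T powr e + (\<Sum>k<n. (2 powr e - 1) * (T * 2 ^ k) powr e)" for n
    proof (induction n)
      case (Suc n)
      have "(T * 2 ^ Suc n) powr e = (2 * (T * 2 ^ n)) powr e" by (simp add: algebra_simps)
      also have "\<dots> = 2 powr e * (T * 2 ^ n) powr e" using assms by (subst powr_mult) auto
      finally show ?case using Suc by (simp add: algebra_simps)
    qed simp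
    have "T * 2 ^ k < a" if "k \<le> N" for k
    proof -
      have "T * 2 ^ k \<le> T * 2 ^ N" using assms that by (intro mult_left_mono power_increasing) auto
      then show ?thesis using False by linarith
    qed
    then have eq: "?S (Suc N) = (\<Sum>k<Suc N. (2 powr e - 1) * (T * 2 ^ k) powr e)"
      by (intro sum.cong) auto
    have "a powr e \<le> (T * 2 ^ Suc N) powr e" using assms Suc.prems by (intro powr_mono2) auto
    then show ?thesis unfolding eq tel[of "Suc N"] .
  qed
qed

text \<open>
  Discrete layer-cake formula from below: a geometric sum is dominated by its last term.
\<close>
lemma dyadic_layers_le_powr:
  fixes T q X :: real
  assumes "T > 0" "q \<ge> 1" "X \<ge> 0"
  shows "(\<Sum>k<N. (T * 2 ^ k) powr q * of_bool (T * 2 ^ k < X)) \<le> 2 * X powr q"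
proof (induction N)
  case (Suc N)
  have geo: "(\<Sum>k<n. (T * 2 ^ k) powr q) \<le> (T * 2 ^ n) powr q" for n
  proof (induction n)
    case (Suc n)
    have "2 powr 1 \<le> 2 powr q" using assms by (intro powr_mono) auto
    then have "2 * (T * 2 ^ n) powr q \<le> 2 powr q * (T * 2 ^ n) powr q" by (intro mult_right_mono) auto
    also have "\<dots> = (2 * (T * 2 ^ n)) powr q" using assms by (subst powr_mult) auto
    finally show ?case using Suc by (simp add: algebra_simps)
  qed simp
  show ?case
  proof (cases "T * 2 ^ N < X")
    case True
    have "(\<Sum>k<Suc N. (T * 2 ^ k) powr q * of_bool (T * 2 ^ k < X)) \<le> (\<Sum>k<Suc N. (T * 2 ^ k) powr q)"
      by (intro sum_mono) auto
    also have "\<dots> \<le> 2 * (T * 2 ^ N) powr q" using geo[of N] by simp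
    also have "\<dots> \<le> 2 * X powr q" using True assms by (intro mult_left_mono powr_mono2) auto
    finally show ?thesis .
  next
    case False
    then show ?thesis using Suc by simp
  qed
qed simp

text \<open>
  Gehring's absorption argument. Writing \<open>f powr (1 + e)\<close> as \<open>f * f powr e\<close> and splitting the second
  factor into dyadic layers, the layer below \<open>T\<close> gives the main term, while
  \<open>mass_of_superlevel_set\<close> bounds all higher layers by a multiple of the integral of
  \<open>f powr (1 + e)\<close> itself. The jumps of \<open>t powr e\<close> carry the small factor \<open>2 powr e - 1\<close>, so for small
  \<open>e\<close> that multiple is at most \<open>1 / 2\<close> and can be absorbed. Boundedness of \<open>f\<close> makes the absorbed
  integral finite; the bound \<open>M\<close> does not enter the conclusion, which permits truncation.
\<close>
lemma reverse_holder_bounded: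
  fixes f :: "'a::euclidean_space \<Rightarrow> real" and u v :: 'a and s t C e M :: real
  defines "P \<equiv> box u v" and "a \<equiv> 2 ^ (DIM('a) + 1)" and "b \<equiv> (10 * real DIM('a)) ^ DIM('a)"
  assumes f: "f \<in> borel_measurable lebesgue" and off: "\<And>x. x \<notin> P \<Longrightarrow> f x = 0"
    and bd: "\<And>x. 0 \<le> f x" "\<And>x. f x \<le> M"
    and side: "\<And>i. i \<in> Basis \<Longrightarrow> v \<bullet> i - u \<bullet> i \<ge> s" and s: "s > 0" and C: "C > 0" and t: "t > 0"
    and A1: "\<And>z l. z \<in> P \<Longrightarrow> l > 0 \<Longrightarrow> AE x in lebesgue. x \<in> cube z l \<inter> P \<longrightarrow>
          (\<integral>\<^sup>+y\<in>cube z l. ennreal (f y) \<partial>lebesgue) \<le> ennreal (C * f x * l ^ DIM('a))"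
    and total: "(\<integral>\<^sup>+y. ennreal (f y) \<partial>lebesgue) \<le> ennreal (t * s ^ DIM('a))"
    and e: "e > 0" "(2 powr e - 1) * (b / a) * (2 * (a * C) powr (1 + e)) \<le> 1 / 2"
  shows "(\<integral>\<^sup>+y. ennreal (f y powr (1 + e)) \<partial>lebesgue)
      \<le> ennreal (2 * (a * t) powr e * t * s ^ DIM('a))"
proof -
  let ?n = "DIM('a)"
  \<comment> \<open>The lowest threshold; superlevel sets at T * 2 ^ k are controlled by heaviness at level t * 2 ^ k.\<close>
  define T where "T = a * t"
  have a: "a \<ge> 1" unfolding a_def by (rule one_le_power) simp
  have b: "b \<ge> 0" unfolding b_def by simp
  have T: "T > 0" using a t by (simp add: T_def)
  obtain N where "M / T < 2 ^ N" using real_arch_pow[of 2 "M / T"] by auto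
  then have N: "M \<le> T * 2 ^ N" using T by (simp add: field_simps)
  have fm [measurable]: "(\<lambda>y. ennreal (f y powr r)) \<in> borel_measurable lebesgue" for r
    using f by measurable
  have fm' [measurable]: "f \<in> borel_measurable lebesgue" by fact
  let ?I = "\<integral>\<^sup>+y. ennreal (f y powr (1 + e)) \<partial>lebesgue"
  have e2: "2 powr e - 1 \<ge> 0" using ge_one_powr_ge_zero[of 2 e] e(1) by simp
  have level: "(\<integral>\<^sup>+y. ennreal (f y * of_bool (f y > T * 2 ^ k)) \<partial>lebesgue)
       \<le> ennreal (b / a * (T * 2 ^ k)) * (\<integral>\<^sup>+y. ennreal (of_bool (a * C * f y > T * 2 ^ k)) \<partial>lebesgue)" for k
  proof -
    define \<tau> where "\<tau> = t * 2 ^ k"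
    have \<tau>: "\<tau> > 0" "\<tau> \<ge> t" "T * 2 ^ k = a * \<tau>" using t by (auto simp: \<tau>_def T_def)
    have "(\<integral>\<^sup>+y. ennreal (f y) \<partial>lebesgue) \<le> ennreal (\<tau> * s ^ ?n)"
      using total \<tau> s by (elim order_trans) (intro ennreal_leI mult_right_mono, auto)
    from mass_of_superlevel_set[OF f off[unfolded P_def] side s C \<tau>(1) A1[unfolded P_def] this]
    have "(\<integral>\<^sup>+y\<in>{y. f y > a * \<tau>}. ennreal (f y) \<partial>lebesgue) \<le> ennreal (b * \<tau>) * emeasure lebesgue {y \<in> P. f y > \<tau> / C}"
      unfolding a_def b_def P_def by simp
    also have "b * \<tau> = b / a * (T * 2 ^ k)" using a \<tau> by simp
    also have "{y \<in> P. f y > \<tau> / C} = {y \<in> space lebesgue. a * C * f y > T * 2 ^ k}"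
      using off C \<tau> a by (auto simp: field_simps) fastforce+
    also have "emeasure lebesgue \<dots> = (\<integral>\<^sup>+y. indicator {y \<in> space lebesgue. a * C * f y > T * 2 ^ k} y \<partial>lebesgue)"
      by (rule nn_integral_indicator[symmetric]) measurable
    also have "\<dots> = (\<integral>\<^sup>+y. ennreal (of_bool (a * C * f y > T * 2 ^ k)) \<partial>lebesgue)"
      by (intro nn_integral_cong) (auto simp: indicator_def)
    also have "(\<integral>\<^sup>+y\<in>{y. f y > a * \<tau>}. ennreal (f y) \<partial>lebesgue) = (\<integral>\<^sup>+y. ennreal (f y * of_bool (f y > T * 2 ^ k)) \<partial>lebesgue)"
      using \<tau> by (intro nn_integral_cong) (auto simp: indicator_def)
    finally show ?thesis .
  qed
  have "?I \<le> (\<integral>\<^sup>+y. ennreal (T powr e) * ennreal (f y) + (\<Sum>k<N. ennreal ((2 powr e - 1) * (T * 2 ^ k) powr e) * ennreal (f y * of_bool (f y > T * 2 ^ k))) \<partial>lebesgue)"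
  proof (rule nn_integral_mono)
    fix y :: 'a
    have "f y powr (1 + e) = f y * f y powr e" using bd(1)[of y] by (simp add: powr_add)
    also have "\<dots> \<le> f y * (T powr e + (\<Sum>k<N. (2 powr e - 1) * (T * 2 ^ k) powr e * of_bool (f y > T * 2 ^ k)))"
      using bd[of y] N by (intro mult_left_mono powr_le_dyadic_layers T e) auto
    also have "\<dots> = T powr e * f y + (\<Sum>k<N. ((2 powr e - 1) * (T * 2 ^ k) powr e) * (f y * of_bool (f y > T * 2 ^ k)))"
      by (simp add: algebra_simps sum_distrib_left)
    finally have "ennreal (f y powr (1 + e)) \<le> ennreal \<dots>" by (rule ennreal_leI)
    also have "\<dots> = ennreal (T powr e) * ennreal (f y) + (\<Sum>k<N. ennreal ((2 powr e - 1) * (T * 2 ^ k) powr e) * ennreal (f y * of_bool (f y > T * 2 ^ k)))"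
      using bd(1)[of y] e2 by (simp add: ennreal_mult sum_ennreal[symmetric] sum_nonneg)
    finally show "ennreal (f y powr (1 + e)) \<le> \<dots>" .
  qed
  also have "\<dots> = ennreal (T powr e) * (\<integral>\<^sup>+y. ennreal (f y) \<partial>lebesgue)
      + (\<Sum>k<N. ennreal ((2 powr e - 1) * (T * 2 ^ k) powr e) * (\<integral>\<^sup>+y. ennreal (f y * of_bool (f y > T * 2 ^ k)) \<partial>lebesgue))"
    by (simp add: nn_integral_add nn_integral_cmult nn_integral_sum)
  also have "\<dots> \<le> ennreal (T powr e) * ennreal (t * s ^ ?n)
      + (\<Sum>k<N. ennreal ((2 powr e - 1) * (T * 2 ^ k) powr e) * (ennreal (b / a * (T * 2 ^ k)) * (\<integral>\<^sup>+y. ennreal (of_bool (a * C * f y > T * 2 ^ k)) \<partial>lebesgue)))"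
    by (intro add_mono mult_left_mono sum_mono level total) auto
  also have "(\<Sum>k<N. ennreal ((2 powr e - 1) * (T * 2 ^ k) powr e) * (ennreal (b / a * (T * 2 ^ k)) * (\<integral>\<^sup>+y. ennreal (of_bool (a * C * f y > T * 2 ^ k)) \<partial>lebesgue)))
     = (\<integral>\<^sup>+y. (\<Sum>k<N. ennreal ((2 powr e - 1) * (T * 2 ^ k) powr e) * (ennreal (b / a * (T * 2 ^ k)) * ennreal (of_bool (a * C * f y > T * 2 ^ k)))) \<partial>lebesgue)"
    by (simp add: nn_integral_cmult nn_integral_sum)
  also have "\<dots> \<le> (\<integral>\<^sup>+y. ennreal (1/2) * ennreal (f y powr (1 + e)) \<partial>lebesgue)"
  proof (rule nn_integral_mono)
    fix y :: 'a
    have "(\<Sum>k<N. ennreal ((2 powr e - 1) * (T * 2 ^ k) powr e) * (ennreal (b / a * (T * 2 ^ k)) * ennreal (of_bool (a * C * f y > T * 2 ^ k))))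
       = (\<Sum>k<N. ennreal ((2 powr e - 1) * (b / a) * ((T * 2 ^ k) powr (1 + e) * of_bool (T * 2 ^ k < a * C * f y))))"
    proof (rule sum.cong[OF refl])
      fix k
      have p: "(T * 2 ^ k) powr (1 + e) = T * 2 ^ k * (T * 2 ^ k) powr e" using T by (simp add: powr_add)
      have "0 \<le> b / a * (T * 2 ^ k)" "0 \<le> (2 powr e - 1) * (T * 2 ^ k) powr e"
        using a b T e2 by auto
      then show "ennreal ((2 powr e - 1) * (T * 2 ^ k) powr e) * (ennreal (b / a * (T * 2 ^ k)) * ennreal (of_bool (a * C * f y > T * 2 ^ k)))
         = ennreal ((2 powr e - 1) * (b / a) * ((T * 2 ^ k) powr (1 + e) * of_bool (T * 2 ^ k < a * C * f y)))"
        unfolding p by (simp add: ennreal_mult[symmetric] mult_ac)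
    qed
    also have "\<dots> = ennreal (\<Sum>k<N. (2 powr e - 1) * (b / a) * ((T * 2 ^ k) powr (1 + e) * of_bool (T * 2 ^ k < a * C * f y)))"
      using a b e2 by (intro sum_ennreal) auto
    also have "(\<Sum>k<N. (2 powr e - 1) * (b / a) * ((T * 2 ^ k) powr (1 + e) * of_bool (T * 2 ^ k < a * C * f y)))
       = (2 powr e - 1) * (b / a) * (\<Sum>k<N. (T * 2 ^ k) powr (1 + e) * of_bool (T * 2 ^ k < a * C * f y))"
      by (simp only: sum_distrib_left)
    also have "\<dots> \<le> (2 powr e - 1) * (b / a) * (2 * (a * C * f y) powr (1 + e))"
      using T e a C bd(1)[of y] b e2 by (intro mult_left_mono dyadic_layers_le_powr) auto
    also have "\<dots> = (2 powr e - 1) * (b / a) * (2 * (a * C) powr (1 + e)) * f y powr (1 + e)"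
      using a C bd(1)[of y] by (simp add: powr_mult)
    also have "\<dots> \<le> 1 / 2 * f y powr (1 + e)" by (intro mult_right_mono e) auto
    finally show "(\<Sum>k<N. ennreal ((2 powr e - 1) * (T * 2 ^ k) powr e) * (ennreal (b / a * (T * 2 ^ k)) * ennreal (of_bool (a * C * f y > T * 2 ^ k))))
        \<le> ennreal (1/2) * ennreal (f y powr (1 + e))"
      by (subst ennreal_mult[symmetric]) (auto intro: ennreal_leI)
  qed
  also have "\<dots> = ennreal (1/2) * ?I" by (simp add: nn_integral_cmult)
  also have "ennreal (T powr e) * ennreal (t * s ^ ?n) = ennreal (T powr e * t * s ^ ?n)"
    using t s by (simp add: ennreal_mult[symmetric] mult.assoc)
  finally have main: "?I \<le> ennreal (T powr e * t * s ^ ?n) + ennreal (1/2) * ?I"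
    by (meson add_mono order_refl order_trans)
  have "?I \<le> (\<integral>\<^sup>+y. ennreal (M powr (1 + e)) * indicator P y \<partial>lebesgue)"
    using bd off e by (intro nn_integral_mono) (auto simp: indicator_def intro!: ennreal_leI powr_mono2)
  also have "\<dots> = ennreal (M powr (1 + e)) * emeasure lebesgue P"
    by (rule nn_integral_cmult_indicator) (simp add: P_def)
  also have "\<dots> < \<infinity>"
  proof -
    have "emeasure lebesgue P < \<infinity>" using bounded_set_imp_lmeasurable[of P]
      unfolding P_def by (metis bounded_box emeasure_bounded_finite emeasure_completion infinity_ennreal_def lmeasurable_box fmeasurableD2 top.not_eq_extremum)
    then show ?thesis by (simp add: ennreal_mult_less_top)
  qed
  finally have "?I < \<infinity>" .
  then obtain I where I: "?I = ennreal I" "I \<ge> 0" by (cases "?I") auto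
  have nn: "T powr e * t * s ^ ?n \<ge> 0" using t s by simp
  have "ennreal (1/2) * ennreal I = ennreal (1/2 * I)" using I(2) by (intro ennreal_mult[symmetric]) auto
  moreover have "ennreal (T powr e * t * s ^ ?n) + ennreal (1/2 * I) = ennreal (T powr e * t * s ^ ?n + 1/2 * I)"
    using nn I(2) by (intro ennreal_plus[symmetric]) auto
  ultimately have "ennreal I \<le> ennreal (T powr e * t * s ^ ?n + 1/2 * I)"
    using main unfolding I(1) by metis
  then have "I \<le> T powr e * t * s ^ ?n + 1/2 * I" using nn I by (subst (asm) ennreal_le_iff) auto
  then have "I \<le> 2 * T powr e * t * s ^ ?n" by simp
  then show ?thesis unfolding I(1) T_def by (rule ennreal_leI)
qed

section \<open>Self-improvement of Muckenhoupt weights\<close>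

text \<open>
  The \<open>A1\<close> condition without restricted measures and without division in the extended reals.
\<close>
lemma A1_iff:
  fixes Q0 :: "'a::euclidean_space set"
  assumes Q0: "Q0 \<in> sets lebesgue"
  shows "v \<in> A1 Q0 \<longleftrightarrow> (\<lambda>x. if x \<in> Q0 then v x else 0) \<in> borel_measurable lebesgue \<and>
     (AE x in lebesgue. x \<in> Q0 \<longrightarrow> 0 < v x) \<and>
     (\<exists>C>0. \<forall>z\<in>Q0. \<forall>l>0. AE x in lebesgue. x \<in> cube z l \<inter> Q0 \<longrightarrow>
        (\<integral>\<^sup>+y\<in>cube z l \<inter> Q0. ennreal (v y) \<partial>lebesgue) \<le> ennreal (C * v x * l ^ DIM('a)))"
proof -
  have m: "v \<in> borel_measurable (lebesgue_on Q0) \<longleftrightarrow> (\<lambda>x. if x \<in> Q0 then v x else 0) \<in> borel_measurable lebesgue"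
    using borel_measurable_if[OF Q0] by blast
  have ae: "(AE x in lebesgue_on S. R x) \<longleftrightarrow> (AE x in lebesgue. x \<in> S \<longrightarrow> R x)" if "S \<in> sets lebesgue" for S and R :: "'a \<Rightarrow> bool"
    using that by (intro AE_restrict_space_iff) auto
  have d: "I / emeasure lebesgue (cube z l) \<le> ennreal (C * a) \<longleftrightarrow> I \<le> ennreal (C * a * l ^ DIM('a))"
    if l: "l > 0" for I C a l and z :: 'a
  proof -
    have p: "ennreal (l ^ DIM('a)) > 0" "ennreal (l ^ DIM('a)) \<noteq> top" using l by auto
    have e: "ennreal (C * a * l ^ DIM('a)) = ennreal (C * a) * ennreal (l ^ DIM('a))"
      using l by (intro ennreal_mult'') auto
    have "I = I / ennreal (l ^ DIM('a)) * ennreal (l ^ DIM('a))"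
    proof -
      have "ennreal (l ^ DIM('a)) / ennreal (l ^ DIM('a)) = 1"
        using l by (intro ennreal_divide_self) auto
      then show ?thesis by (simp only: ennreal_divide_times mult_1_right)
    qed
    then have "I / ennreal (l ^ DIM('a)) \<le> ennreal (C * a) \<Longrightarrow> I \<le> ennreal (C * a) * ennreal (l ^ DIM('a))"
      by (metis mult_right_mono zero_le)
    moreover have "I \<le> ennreal (C * a) * ennreal (l ^ DIM('a)) \<Longrightarrow> I / ennreal (l ^ DIM('a)) \<le> ennreal (C * a)"
      using p by (intro divide_le_posI_ennreal) (auto simp: mult.commute)
    ultimately show ?thesis unfolding e emeasure_cube[OF less_imp_le[OF l]] by blast
  qed
  have i: "(\<integral>\<^sup>+y. ennreal (v y) \<partial>lebesgue_on (cube z l \<inter> Q0)) = (\<integral>\<^sup>+y\<in>cube z l \<inter> Q0. ennreal (v y) \<partial>lebesgue)" for z l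
    using Q0 by (intro nn_integral_restrict_space) auto
  have "(AE x in lebesgue_on (cube z l \<inter> Q0). (\<integral>\<^sup>+y. ennreal (v y) \<partial>lebesgue_on (cube z l \<inter> Q0)) / emeasure lebesgue (cube z l) \<le> ennreal (C * v x))
     \<longleftrightarrow> (AE x in lebesgue. x \<in> cube z l \<inter> Q0 \<longrightarrow>
        (\<integral>\<^sup>+y\<in>cube z l \<inter> Q0. ennreal (v y) \<partial>lebesgue) \<le> ennreal (C * v x * l ^ DIM('a)))"
    if "l > 0" for z l C
  proof -
    have "cube z l \<inter> Q0 \<in> sets lebesgue" using Q0 by auto
    then show ?thesis by (simp only: ae i d[OF that])
  qed
  then show ?thesis unfolding A1_def weight_on_def using m ae[OF Q0] by auto
qed

lemma is_cubeE:
  fixes Q0 :: "'a::euclidean_space set"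
  assumes "is_cube Q0"
  obtains c L where "L > 0" "cube c L \<subseteq> Q0" "Q0 \<subseteq> closure (cube c L)"
    "Q0 - cube c L \<in> null_sets lebesgue" "Q0 \<in> sets lebesgue"
    "\<And>x i. x \<in> Q0 \<Longrightarrow> i \<in> Basis \<Longrightarrow> \<bar>x \<bullet> i - c \<bullet> i\<bar> \<le> L / 2"
proof -
  obtain c L where cL: "L > 0" "cube c L \<subseteq> Q0" "Q0 \<subseteq> closure (cube c L)"
    using assms unfolding is_cube_def by blast
  have "convex (cube c L)" unfolding cube_def by (rule convex_box)
  then have "negligible (closure (cube c L) - cube c L)"
    using negligible_convex_frontier[of "cube c L"] by (simp add: frontier_def interior_open)
  then have n: "Q0 - cube c L \<in> null_sets lebesgue"
    using cL by (meson Diff_mono negligible_iff_null_sets negligible_subset order_refl)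
  then have "cube c L \<union> (Q0 - cube c L) \<in> sets lebesgue" by (intro sets.Un) auto
  then have s: "Q0 \<in> sets lebesgue" using cL by (simp add: Un_absorb1)
  have "closure (cube c L) \<subseteq> {x. \<forall>i\<in>Basis. \<bar>x \<bullet> i - c \<bullet> i\<bar> \<le> L / 2}"
  proof (rule closure_minimal)
    show "cube c L \<subseteq> {x. \<forall>i\<in>Basis. \<bar>x \<bullet> i - c \<bullet> i\<bar> \<le> L / 2}" by (auto simp: mem_cube less_imp_le)
    show "closed {x. \<forall>i\<in>Basis. \<bar>x \<bullet> i - c \<bullet> i\<bar> \<le> L / 2}"
      unfolding Ball_def by (intro closed_Collect_all closed_Collect_imp open_Collect_const closed_Collect_le continuous_intros)
  qed
  then show thesis using that[OF cL n s] cL by blast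
qed

lemma exists_small_exponent:
  fixes K A :: real
  assumes "A > 0"
  obtains e where "e > 0" "(2 powr e - 1) * K * (2 * A powr (1 + e)) \<le> 1 / 2"
proof -
  have "((\<lambda>e. (2 powr e - 1) * K * (2 * A powr (1 + e))) \<longlongrightarrow> (2 powr 0 - 1) * K * (2 * A powr (1 + 0))) (at_right (0::real))"
    using assms by (intro tendsto_intros) auto
  then have "eventually (\<lambda>e. (2 powr e - 1) * K * (2 * A powr (1 + e)) < 1/2) (at_right (0::real))"
    by (intro order_tendstoD) auto
  then obtain b where b: "b > 0" "\<And>e. 0 < e \<Longrightarrow> e < b \<Longrightarrow> (2 powr e - 1) * K * (2 * A powr (1 + e)) < 1/2"
    unfolding eventually_at_right_field by auto
  show thesis using b that[of "b/2"] by (simp add: less_imp_le)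
qed

text \<open>
  The reverse Hoelder property of \<open>A1\<close> weights, in its \<open>A1\<close> form. For a cube \<open>Q\<close> centred in \<open>Q0\<close>, the
  set \<open>Q \<inter> Q0\<close> is essentially a box \<open>P\<close> whose sides are comparable to that of \<open>Q\<close>. The \<open>A1\<close> constant
  is inherited by subsets of \<open>Q0\<close> and by the truncations \<open>min w N\<close>, so \<open>reverse_holder_bounded\<close>
  applies on \<open>P\<close> uniformly in \<open>N\<close>. The base level \<open>t\<close> is chosen as a multiple of \<open>w x\<close> for a typical
  point \<open>x\<close>, so the resulting bound is directly the \<open>A1\<close> inequality at \<open>x\<close>.
\<close>
lemma A1_self_improvement:
  fixes Q0 :: "'a::euclidean_space set" and w :: "'a \<Rightarrow> real"
  assumes cube: "is_cube Q0" and w: "w \<in> A1 Q0"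
  obtains \<delta> where "\<delta> > 0" "(\<lambda>x. w x powr (1 + \<delta>)) \<in> A1 Q0"
proof -
  let ?n = "DIM('a)"
  obtain c L where Q: "L > 0" "cube c L \<subseteq> Q0" "Q0 - cube c L \<in> null_sets lebesgue"
      "Q0 \<in> sets lebesgue" "\<And>x i. x \<in> Q0 \<Longrightarrow> i \<in> Basis \<Longrightarrow> \<bar>x \<bullet> i - c \<bullet> i\<bar> \<le> L / 2"
    using is_cubeE[OF cube] by metis
  note iff = A1_iff[OF Q(4)]
  define g where "g = (\<lambda>x. if x \<in> Q0 then w x else 0)"
  have g: "g \<in> borel_measurable lebesgue" and wpos: "AE x in lebesgue. x \<in> Q0 \<longrightarrow> 0 < w x"
    using w iff unfolding g_def by auto
  obtain C0 where C0: "\<And>z l. z \<in> Q0 \<Longrightarrow> l > 0 \<Longrightarrow> AE x in lebesgue. x \<in> cube z l \<inter> Q0 \<longrightarrow>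
        (\<integral>\<^sup>+y\<in>cube z l \<inter> Q0. ennreal (w y) \<partial>lebesgue) \<le> ennreal (C0 * w x * l ^ ?n)" "C0 > 0"
    using w iff[of w] by blast
  \<comment> \<open>A constant at least 1 survives truncation: averages of min w N are at most N.\<close>
  define C where "C = max 1 C0"
  have C: "C \<ge> 1" "C > 0" by (auto simp: C_def)
  have A1w: "AE x in lebesgue. x \<in> cube z l \<inter> Q0 \<longrightarrow>
        (\<integral>\<^sup>+y\<in>cube z l \<inter> Q0. ennreal (w y) \<partial>lebesgue) \<le> ennreal (C * w x * l ^ ?n)" if "z \<in> Q0" "l > 0" for z l
    using C0(1)[OF that] wpos
  proof (eventually_elim, intro impI)
    fix x assume x: "x \<in> Q0 \<longrightarrow> 0 < w x" "x \<in> cube z l \<inter> Q0"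
      and I: "x \<in> cube z l \<inter> Q0 \<longrightarrow> (\<integral>\<^sup>+y\<in>cube z l \<inter> Q0. ennreal (w y) \<partial>lebesgue) \<le> ennreal (C0 * w x * l ^ ?n)"
    have "C0 * w x * l ^ ?n \<le> C * w x * l ^ ?n"
      using x that by (intro mult_right_mono) (auto simp: C_def)
    then show "(\<integral>\<^sup>+y\<in>cube z l \<inter> Q0. ennreal (w y) \<partial>lebesgue) \<le> ennreal (C * w x * l ^ ?n)"
      using I x by (meson ennreal_leI order_trans)
  qed
  define a b :: real where "a = 2 ^ (?n + 1)" and "b = (10 * real ?n) ^ ?n"
  have a: "a > 0" by (simp add: a_def)
  obtain e where e: "e > 0" "(2 powr e - 1) * (b / a) * (2 * (a * C) powr (1 + e)) \<le> 1 / 2"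
    using exists_small_exponent[of "a * C" "b / a"] a C by auto
  define K where "K = 2 * (a * C * 6 ^ ?n) powr e * C"
  have K: "K > 0" unfolding K_def using a C by simp
  \<comment> \<open>For cubes much larger than Q0 the sides of P are no longer comparable to l; 3 * L is a scale
    at which cubes centred in Q0 already contain Q0.\<close>
  have moderate: "AE x in lebesgue. x \<in> cube z l \<inter> Q0 \<longrightarrow>
        (\<integral>\<^sup>+y\<in>cube z l \<inter> Q0. ennreal (w y powr (1 + e)) \<partial>lebesgue) \<le> ennreal (K * w x powr (1 + e) * l ^ ?n)"
    if z: "z \<in> Q0" and l: "l > 0" "l \<le> 3 * L" for z l
  proof -
    define P where "P = cube z l \<inter> cube c L"
    \<comment> \<open>The sides of P are at least min (l / 2) (L / 2), and l is at most 3 * L.\<close>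
    define s where "s = l / 6"
    have s: "s > 0" using l by (simp add: s_def)
    obtain u v where uv: "P = box u v" "\<And>i. i \<in> Basis \<Longrightarrow> v \<bullet> i - u \<bullet> i \<ge> s"
    proof
      let ?u = "\<Sum>i\<in>Basis. max (z \<bullet> i - l/2) (c \<bullet> i - L/2) *\<^sub>R i :: 'a"
      let ?v = "\<Sum>i\<in>Basis. min (z \<bullet> i + l/2) (c \<bullet> i + L/2) *\<^sub>R i :: 'a"
      have "\<bar>x \<bullet> i - z \<bullet> i\<bar> < l / 2 \<and> \<bar>x \<bullet> i - c \<bullet> i\<bar> < L / 2 \<longleftrightarrow> ?u \<bullet> i < x \<bullet> i \<and> x \<bullet> i < ?v \<bullet> i"
        if i: "i \<in> Basis" for x i :: 'a
      proof -
        have "?u \<bullet> i = max (z \<bullet> i - l/2) (c \<bullet> i - L/2)" "?v \<bullet> i = min (z \<bullet> i + l/2) (c \<bullet> i + L/2)"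
          using i by simp_all
        then show ?thesis unfolding abs_less_iff by (simp only: max_less_iff_conj min_less_iff_conj) argo
      qed
      then show "P = box ?u ?v"
        unfolding P_def set_eq_iff Int_iff mem_cube mem_box by blast
      show "?v \<bullet> i - ?u \<bullet> i \<ge> s" if i: "i \<in> Basis" for i
      proof -
        have "z \<bullet> i - c \<bullet> i \<le> L / 2" "c \<bullet> i - z \<bullet> i \<le> L / 2"
          using Q(5)[OF z i] unfolding abs_le_iff by linarith+
        then show ?thesis using i l Q(1) by (simp add: s_def min_def max_def)
      qed
    qed
    have PQ: "P \<subseteq> cube z l \<inter> Q0" using Q(2) by (auto simp: P_def)
    have P: "P \<in> sets lebesgue" by (simp add: uv)
    have nullP: "AE x in lebesgue. x \<in> cube z l \<inter> Q0 \<longrightarrow> x \<in> P"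
      using AE_not_in[OF Q(3)] by (rule eventually_mono) (auto simp: P_def)
    define f where "f = (\<lambda>N x. if x \<in> P then min (max 0 (g x)) (real N) else 0)"
    have f [measurable]: "f N \<in> borel_measurable lebesgue" for N
      unfolding f_def using g P by measurable
    have f_le: "ennreal (f N y) \<le> ennreal (w y) * indicator (cube z l \<inter> Q0) y" for N y
      using PQ by (auto simp: f_def g_def indicator_def max_def min_def intro!: ennreal_leI)
    have A1f: "AE x in lebesgue. x \<in> cube z' l' \<inter> box u v \<longrightarrow>
          (\<integral>\<^sup>+y\<in>cube z' l'. ennreal (f N y) \<partial>lebesgue) \<le> ennreal (C * f N x * l' ^ ?n)"
      if z': "z' \<in> box u v" and l': "l' > 0" for z' l' N
    proof -
      have z'Q: "z' \<in> Q0" using z' PQ uv by auto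
      show ?thesis using A1w[OF z'Q l'] wpos
      proof (eventually_elim, intro impI)
        fix x assume wx: "x \<in> Q0 \<longrightarrow> 0 < w x" and x: "x \<in> cube z' l' \<inter> box u v"
          and I: "x \<in> cube z' l' \<inter> Q0 \<longrightarrow> (\<integral>\<^sup>+y\<in>cube z' l' \<inter> Q0. ennreal (w y) \<partial>lebesgue) \<le> ennreal (C * w x * l' ^ ?n)"
        have xQ: "x \<in> P" "x \<in> Q0" "x \<in> cube z' l'" using x uv PQ by auto
        have "(\<integral>\<^sup>+y\<in>cube z' l'. ennreal (f N y) \<partial>lebesgue) \<le> (\<integral>\<^sup>+y\<in>cube z' l' \<inter> Q0. ennreal (w y) \<partial>lebesgue)"
        proof (rule nn_integral_mono)
          fix y :: 'a
          have "ennreal (f N y) * indicator (cube z' l') y \<le> ennreal (w y) * indicator (cube z l \<inter> Q0) y * indicator (cube z' l') y"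
            by (intro mult_right_mono f_le) simp
          also have "\<dots> \<le> ennreal (w y) * indicator (cube z' l' \<inter> Q0) y" by (auto simp: indicator_def)
          finally show "ennreal (f N y) * indicator (cube z' l') y \<le> ennreal (w y) * indicator (cube z' l' \<inter> Q0) y" .
        qed
        also have "\<dots> \<le> ennreal (C * w x * l' ^ ?n)" using I xQ by auto
        finally have 1: "(\<integral>\<^sup>+y\<in>cube z' l'. ennreal (f N y) \<partial>lebesgue) \<le> ennreal (C * w x * l' ^ ?n)" .
        have "(\<integral>\<^sup>+y\<in>cube z' l'. ennreal (f N y) \<partial>lebesgue) \<le> (\<integral>\<^sup>+y. ennreal (real N) * indicator (cube z' l') y \<partial>lebesgue)"
          by (intro nn_integral_mono) (auto simp: f_def indicator_def intro!: ennreal_leI)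
        also have "\<dots> = ennreal (real N) * emeasure lebesgue (cube z' l')"
          by (rule nn_integral_cmult_indicator) simp
        also have "\<dots> = ennreal (real N * l' ^ ?n)"
          unfolding emeasure_cube[OF less_imp_le[OF l']] using l' by (simp add: ennreal_mult)
        also have "\<dots> \<le> ennreal (C * real N * l' ^ ?n)"
          using C l' by (intro ennreal_leI mult_right_mono) (auto simp: mult_le_cancel_right1)
        finally have 2: "(\<integral>\<^sup>+y\<in>cube z' l'. ennreal (f N y) \<partial>lebesgue) \<le> ennreal (C * real N * l' ^ ?n)" .
        show "(\<integral>\<^sup>+y\<in>cube z' l'. ennreal (f N y) \<partial>lebesgue) \<le> ennreal (C * f N x * l' ^ ?n)"
          using 1 2 xQ wx by (auto simp: f_def g_def min_def)
      qed
    qed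
    have "AE x in lebesgue. x \<in> cube z l \<inter> Q0 \<longrightarrow> 0 < w x \<and>
       (\<integral>\<^sup>+y\<in>cube z l \<inter> Q0. ennreal (w y) \<partial>lebesgue) \<le> ennreal (C * w x * l ^ ?n)"
      using A1w[OF z l(1)] wpos by eventually_elim auto
    then show ?thesis
    proof (rule eventually_mono, intro impI)
      fix x assume *: "x \<in> cube z l \<inter> Q0 \<longrightarrow> 0 < w x \<and>
       (\<integral>\<^sup>+y\<in>cube z l \<inter> Q0. ennreal (w y) \<partial>lebesgue) \<le> ennreal (C * w x * l ^ ?n)" and x: "x \<in> cube z l \<inter> Q0"
      have wx: "w x > 0" and I: "(\<integral>\<^sup>+y\<in>cube z l \<inter> Q0. ennreal (w y) \<partial>lebesgue) \<le> ennreal (C * w x * l ^ ?n)"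
        using * x by auto
      define t where "t = C * w x * 6 ^ ?n"
      have t: "t > 0" using C wx by (simp add: t_def)
      have ts: "t * s ^ ?n = C * w x * l ^ ?n" by (simp add: t_def s_def power_divide)
      have bound: "(\<integral>\<^sup>+y. ennreal (f N y powr (1 + e)) \<partial>lebesgue) \<le> ennreal (K * w x powr (1 + e) * l ^ ?n)" for N
      proof -
        have "(\<integral>\<^sup>+y. ennreal (f N y) \<partial>lebesgue) \<le> (\<integral>\<^sup>+y\<in>cube z l \<inter> Q0. ennreal (w y) \<partial>lebesgue)"
          using f_le by (rule nn_integral_mono)
        then have tot: "(\<integral>\<^sup>+y. ennreal (f N y) \<partial>lebesgue) \<le> ennreal (t * s ^ ?n)"
          using I unfolding ts by (rule order_trans)
        have "(\<integral>\<^sup>+y. ennreal (f N y powr (1 + e)) \<partial>lebesgue) \<le> ennreal (2 * (a * t) powr e * t * s ^ ?n)"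
          unfolding a_def
          by (rule reverse_holder_bounded[OF f[of N], where u = u and v = v and M = "real N" and C = C])
            (use uv s C t A1f tot e in \<open>auto simp: f_def a_def b_def\<close>)
        also have "2 * (a * t) powr e * t * s ^ ?n = K * w x powr (1 + e) * l ^ ?n"
        proof -
          have "(a * t) powr e = (a * C * 6 ^ ?n) powr e * w x powr e"
            using a C wx by (subst powr_mult[symmetric]) (auto simp: t_def mult_ac)
          moreover have "w x powr (1 + e) = w x * w x powr e" using wx by (simp add: powr_add)
          ultimately show ?thesis unfolding K_def mult.assoc ts[unfolded mult.assoc] by (simp add: mult_ac)
        qed
        finally show ?thesis .
      qed
      have "(\<integral>\<^sup>+y\<in>cube z l \<inter> Q0. ennreal (w y powr (1 + e)) \<partial>lebesgue) \<le> (\<integral>\<^sup>+y. (SUP N. ennreal (f N y powr (1 + e))) \<partial>lebesgue)"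
        using nullP wpos
      proof (intro nn_integral_mono_AE, eventually_elim)
        fix y assume y: "y \<in> cube z l \<inter> Q0 \<longrightarrow> y \<in> P" "y \<in> Q0 \<longrightarrow> 0 < w y"
        show "ennreal (w y powr (1 + e)) * indicator (cube z l \<inter> Q0) y \<le> (SUP N. ennreal (f N y powr (1 + e)))"
        proof (cases "y \<in> cube z l \<inter> Q0")
          case True
          obtain N where "w y \<le> real N" using real_arch_simple by blast
          then have "f N y = w y" using True y by (auto simp: f_def g_def)
          then show ?thesis using True by (auto intro: SUP_upper2[of N])
        qed auto
      qed
      also have "\<dots> = (SUP N. \<integral>\<^sup>+y. ennreal (f N y powr (1 + e)) \<partial>lebesgue)"
      proof (rule nn_integral_monotone_convergence_SUP)
        show "incseq (\<lambda>N y. ennreal (f N y powr (1 + e)))"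
          using e by (intro incseq_SucI le_funI ennreal_leI powr_mono2) (auto simp: f_def)
      qed measurable
      also have "\<dots> \<le> ennreal (K * w x powr (1 + e) * l ^ ?n)" by (rule SUP_least) (rule bound)
      finally show "(\<integral>\<^sup>+y\<in>cube z l \<inter> Q0. ennreal (w y powr (1 + e)) \<partial>lebesgue) \<le> ennreal (K * w x powr (1 + e) * l ^ ?n)" .
    qed
  qed
  have all: "AE x in lebesgue. x \<in> cube z l \<inter> Q0 \<longrightarrow>
        (\<integral>\<^sup>+y\<in>cube z l \<inter> Q0. ennreal (w y powr (1 + e)) \<partial>lebesgue) \<le> ennreal (K * w x powr (1 + e) * l ^ ?n)"
    if z: "z \<in> Q0" and l: "l > 0" for z l
  proof (cases "l \<le> 3 * L")
    case True
    then show ?thesis using moderate[OF z l] by blast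
  next
    case False
    have sub: "Q0 \<subseteq> cube z (3 * L)"
    proof
      fix x assume x: "x \<in> Q0"
      have "\<bar>x \<bullet> i - z \<bullet> i\<bar> < 3 * L / 2" if i: "i \<in> Basis" for i
        using Q(5)[OF x i] Q(5)[OF z i] Q(1) by linarith
      then show "x \<in> cube z (3 * L)" by (simp add: mem_cube)
    qed
    then have eq: "cube z (3 * L) \<inter> Q0 = Q0" "cube z l \<inter> Q0 = Q0"
      using cube_mono[of "3 * L" l z] False by auto
    have le: "K * w x powr (1 + e) * (3 * L) ^ ?n \<le> K * w x powr (1 + e) * l ^ ?n" for x
      using False Q(1) K by (intro mult_left_mono power_mono) auto
    have "3 * L > 0" using Q(1) by simp
    from moderate[OF z this order_refl, unfolded eq] show ?thesis
      unfolding eq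
    proof (rule eventually_mono, intro impI)
      fix x assume "x \<in> Q0 \<longrightarrow> (\<integral>\<^sup>+y\<in>Q0. ennreal (w y powr (1 + e)) \<partial>lebesgue) \<le> ennreal (K * w x powr (1 + e) * (3 * L) ^ ?n)"
        and "x \<in> Q0"
      then show "(\<integral>\<^sup>+y\<in>Q0. ennreal (w y powr (1 + e)) \<partial>lebesgue) \<le> ennreal (K * w x powr (1 + e) * l ^ ?n)"
        using ennreal_leI[OF le[of x]] order_trans by blast
    qed
  qed
  have "(\<lambda>x. w x powr (1 + e)) \<in> A1 Q0"
    unfolding iff
  proof (intro conjI)
    have "(\<lambda>x. if x \<in> Q0 then w x powr (1 + e) else 0) = (\<lambda>x. g x powr (1 + e))"
      by (auto simp: g_def)
    then show "(\<lambda>x. if x \<in> Q0 then w x powr (1 + e) else 0) \<in> borel_measurable lebesgue"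
      using g by simp
    show "AE x in lebesgue. x \<in> Q0 \<longrightarrow> 0 < w x powr (1 + e)" using wpos by eventually_elim auto
    show "\<exists>C>0. \<forall>z\<in>Q0. \<forall>l>0. AE x in lebesgue. x \<in> cube z l \<inter> Q0 \<longrightarrow>
        (\<integral>\<^sup>+y\<in>cube z l \<inter> Q0. ennreal (w y powr (1 + e)) \<partial>lebesgue) \<le> ennreal (C * w x powr (1 + e) * l ^ ?n)"
      using all K by blast
  qed
  then show thesis using that e(1) by blast
qed

section \<open>Closure properties of the class\<close>

text \<open>
  The extended-real average makes \<open>A1\<close> weights integrable: the inequality for a cube containing \<open>Q0\<close>
  has a finite right-hand side at some point, since \<open>Q0\<close> has positive measure.
\<close>
lemma A1_integral_finite:
  fixes Q0 :: "'a::euclidean_space set"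
  assumes cube: "is_cube Q0" and v: "v \<in> A1 Q0"
  shows "(\<integral>\<^sup>+y\<in>Q0. ennreal (v y) \<partial>lebesgue) < \<infinity>"
proof (rule ccontr)
  obtain c L where Q: "L > 0" "cube c L \<subseteq> Q0" "Q0 \<in> sets lebesgue"
     "\<And>x i. x \<in> Q0 \<Longrightarrow> i \<in> Basis \<Longrightarrow> \<bar>x \<bullet> i - c \<bullet> i\<bar> \<le> L / 2"
    using is_cubeE[OF cube] by metis
  assume "\<not> ?thesis"
  then have inf: "(\<integral>\<^sup>+y\<in>Q0. ennreal (v y) \<partial>lebesgue) = top" by (metis infinity_ennreal_def less_top)
  have c: "c \<in> Q0" using Q(1,2) by (auto simp: mem_cube subset_eq)
  have "Q0 \<subseteq> cube c (3 * L)"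
  proof
    fix x assume x: "x \<in> Q0"
    have "\<bar>x \<bullet> i - c \<bullet> i\<bar> < 3 * L / 2" if i: "i \<in> Basis" for i
      using Q(4)[OF x i] Q(1) by linarith
    then show "x \<in> cube c (3 * L)" by (simp add: mem_cube)
  qed
  then have eq: "cube c (3 * L) \<inter> Q0 = Q0" by auto
  obtain C where "\<forall>z\<in>Q0. \<forall>l>0. AE x in lebesgue. x \<in> cube z l \<inter> Q0 \<longrightarrow>
        (\<integral>\<^sup>+y\<in>cube z l \<inter> Q0. ennreal (v y) \<partial>lebesgue) \<le> ennreal (C * v x * l ^ DIM('a))"
    using v unfolding A1_iff[OF Q(3)] by blast
  moreover have "3 * L > 0" using Q(1) by simp
  ultimately have "AE x in lebesgue. x \<in> cube c (3 * L) \<inter> Q0 \<longrightarrow>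
        (\<integral>\<^sup>+y\<in>cube c (3 * L) \<inter> Q0. ennreal (v y) \<partial>lebesgue) \<le> ennreal (C * v x * (3 * L) ^ DIM('a))"
    using c by blast
  then have "AE x in lebesgue. x \<notin> Q0"
    unfolding eq inf by (rule eventually_mono) (auto simp: top_unique)
  then have "AE x in lebesgue. x \<notin> cube c L" using Q(2) by (auto elim: eventually_mono)
  then have "emeasure lebesgue (cube c L) = 0"
    using AE_iff_measurable[of "cube c L" lebesgue "\<lambda>x. x \<notin> cube c L"] by simp
  then show False using Q(1) emeasure_cube[of L c] by simp
qed

text \<open>
  For integrable \<open>v \<ge> 1\<close> large cubes are harmless: their averages are bounded, and \<open>v\<close> is bounded
  below. Only small cubes need an argument.
\<close>
lemma A1_of_small_cubes:
  fixes Q0 :: "'a::euclidean_space set"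
  assumes Q0: "Q0 \<in> sets lebesgue" and meas: "v \<in> borel_measurable (lebesgue_on Q0)"
    and ge1: "AE x in lebesgue. x \<in> Q0 \<longrightarrow> 1 \<le> v x"
    and fin: "(\<integral>\<^sup>+y\<in>Q0. ennreal (v y) \<partial>lebesgue) < \<infinity>"
    and l0: "l0 > 0"
    and small: "\<And>z l. z \<in> Q0 \<Longrightarrow> 0 < l \<Longrightarrow> l \<le> l0 \<Longrightarrow> AE x in lebesgue. x \<in> cube z l \<inter> Q0 \<longrightarrow>
        (\<integral>\<^sup>+y\<in>cube z l \<inter> Q0. ennreal (v y) \<partial>lebesgue) \<le> ennreal (C * v x * l ^ DIM('a))"
  shows "v \<in> A1 Q0"
proof -
  obtain I where I: "(\<integral>\<^sup>+y\<in>Q0. ennreal (v y) \<partial>lebesgue) = ennreal I" "I \<ge> 0"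
    using fin by (cases "\<integral>\<^sup>+y\<in>Q0. ennreal (v y) \<partial>lebesgue") auto
  define C' where "C' = max 1 (max C (I / l0 ^ DIM('a)))"
  have "AE x in lebesgue. x \<in> cube z l \<inter> Q0 \<longrightarrow>
        (\<integral>\<^sup>+y\<in>cube z l \<inter> Q0. ennreal (v y) \<partial>lebesgue) \<le> ennreal (C' * v x * l ^ DIM('a))"
    if z: "z \<in> Q0" and l: "l > 0" for z l
  proof (cases "l \<le> l0")
    case True
    show ?thesis using small[OF z l True] ge1
    proof eventually_elim
      case (elim x)
      show ?case (is "_ \<longrightarrow> ?concl")
      proof
      assume xB: "x \<in> cube z l \<inter> Q0"
      have "C * v x * l ^ DIM('a) \<le> C' * v x * l ^ DIM('a)"
        using elim xB l by (intro mult_right_mono) (auto simp: C'_def)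
      then show ?concl using elim xB by (meson ennreal_leI order_trans)
      qed
    qed
  next
    case False
    show ?thesis using ge1
    proof eventually_elim
      case (elim x)
      show ?case (is "_ \<longrightarrow> ?concl")
      proof
      assume xB: "x \<in> cube z l \<inter> Q0"
      have "(\<integral>\<^sup>+y\<in>cube z l \<inter> Q0. ennreal (v y) \<partial>lebesgue) \<le> ennreal I"
        unfolding I(1)[symmetric] by (intro nn_integral_mono) (auto simp: indicator_def)
      also have "I = I / l0 ^ DIM('a) * 1 * l0 ^ DIM('a)" using l0 by simp
      also have "ennreal \<dots> \<le> ennreal (C' * v x * l ^ DIM('a))"
        using elim xB False l0 I(2) by (intro ennreal_leI mult_mono power_mono) (auto simp: C'_def)
      finally show ?concl .
      qed
    qed
  qed
  moreover have "C' > 0" by (simp add: C'_def)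
  moreover have "AE x in lebesgue. x \<in> Q0 \<longrightarrow> 0 < v x" using ge1 by eventually_elim auto
  moreover have "(\<lambda>x. if x \<in> Q0 then v x else 0) \<in> borel_measurable lebesgue"
    using meas borel_measurable_if[OF Q0] by blast
  ultimately show ?thesis unfolding A1_iff[OF Q0] by blast
qed

text \<open>
  A pointwise replacement for Jensen's inequality: after normalising by \<open>t\<close>, an intermediate power
  is at most \<open>1\<close> plus the top power.
\<close>
lemma powr_interpolation:
  fixes y t a q :: real
  assumes "t > 0" "y \<ge> 0" "0 < a" "a \<le> q"
  shows "y powr a \<le> t powr a * (1 + (y / t) powr q)"
proof -
  define r where "r = y / t"
  have r: "r \<ge> 0" "y = t * r" using assms by (auto simp: r_def)
  have "r powr a \<le> 1 + r powr q"
  proof (cases "r \<le> 1")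
    case True
    then have "r powr a \<le> 1" using r assms by (simp add: powr_le1)
    then show ?thesis using powr_ge_zero[of r q] by linarith
  next
    case False
    then have "r powr a \<le> r powr q" using assms by (intro powr_mono) auto
    then show ?thesis by linarith
  qed
  then have "t powr a * r powr a \<le> t powr a * (1 + r powr q)" by (rule mult_left_mono) simp
  then show ?thesis using r assms by (simp add: powr_mult)
qed

text \<open>
  Membership in \<open>A1\<close> passes down from the power \<open>q\<close> to smaller positive powers: integrate
  \<open>powr_interpolation\<close> over the cube with the normalisation \<open>t = w x\<close>.
\<close>
lemma A1_powr_interpolation:
  fixes Q0 :: "'a::euclidean_space set"
  assumes Q0: "Q0 \<in> sets lebesgue" and w: "weight_on Q0 w"
    and A1: "(\<lambda>x. w x powr q) \<in> A1 Q0" and a: "0 < a" "a \<le> q"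
  shows "(\<lambda>x. w x powr a) \<in> A1 Q0"
proof -
  let ?n = "DIM('a)"
  define g where "g = (\<lambda>x. if x \<in> Q0 then w x else 0)"
  have g [measurable]: "g \<in> borel_measurable lebesgue"
    using w borel_measurable_if[OF Q0] unfolding weight_on_def g_def by blast
  have pos: "AE x in lebesgue. x \<in> Q0 \<longrightarrow> 0 < w x"
    using w Q0 unfolding weight_on_def by (simp add: AE_restrict_space_iff)
  obtain K where K: "K > 0" "\<And>z l. z \<in> Q0 \<Longrightarrow> l > 0 \<Longrightarrow> AE x in lebesgue. x \<in> cube z l \<inter> Q0 \<longrightarrow>
        (\<integral>\<^sup>+y\<in>cube z l \<inter> Q0. ennreal (w y powr q) \<partial>lebesgue) \<le> ennreal (K * w x powr q * l ^ ?n)"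
    using A1 unfolding A1_iff[OF Q0] by blast
  have "AE x in lebesgue. x \<in> cube z l \<inter> Q0 \<longrightarrow>
        (\<integral>\<^sup>+y\<in>cube z l \<inter> Q0. ennreal (w y powr a) \<partial>lebesgue) \<le> ennreal ((1 + K) * w x powr a * l ^ ?n)"
    if z: "z \<in> Q0" and l: "l > 0" for z l
    using K(2)[OF z l] pos
  proof eventually_elim
    case (elim x)
    show ?case (is "_ \<longrightarrow> ?concl")
    proof
    assume xB: "x \<in> cube z l \<inter> Q0"
    define t where "t = w x"
    have t: "t > 0" using elim xB by (auto simp: t_def)
    define B where "B = cube z l \<inter> Q0"
    have B [measurable]: "B \<in> sets lebesgue" using Q0 by (simp add: B_def)
    have "(\<integral>\<^sup>+y\<in>B. ennreal (w y powr a) \<partial>lebesgue)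
       \<le> (\<integral>\<^sup>+y. ennreal (t powr a) * indicator B y + ennreal (t powr (a - q)) * (ennreal (g y powr q) * indicator B y) \<partial>lebesgue)"
      using pos
    proof (intro nn_integral_mono_AE, eventually_elim)
      case (elim y)
      show ?case
      proof (cases "y \<in> B")
        case True
        then have y: "w y > 0" "g y = w y" using elim by (auto simp: B_def g_def)
        have "w y powr a \<le> t powr a * (1 + (w y / t) powr q)"
          using y t a by (intro powr_interpolation) auto
        also have "\<dots> = t powr a + t powr (a - q) * w y powr q"
          using y t by (simp add: powr_divide powr_diff field_simps)
        finally have "ennreal (w y powr a) \<le> ennreal (t powr a + t powr (a - q) * w y powr q)" by (rule ennreal_leI)
        then show ?thesis using True y by (simp add: ennreal_mult)
      qed simp
    qed
    also have "\<dots> = ennreal (t powr a) * emeasure lebesgue B + ennreal (t powr (a - q)) * (\<integral>\<^sup>+y\<in>B. ennreal (g y powr q) \<partial>lebesgue)"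
      by (subst nn_integral_add) (simp_all add: nn_integral_cmult nn_integral_cmult_indicator del: emeasure_completion)
    also have "\<dots> \<le> ennreal (t powr a) * ennreal (l ^ ?n) + ennreal (t powr (a - q)) * ennreal (K * t powr q * l ^ ?n)"
    proof (intro add_mono mult_left_mono)
      have "emeasure lebesgue B \<le> emeasure lebesgue (cube z l)"
        by (rule emeasure_mono) (auto simp: B_def)
      then show "emeasure lebesgue B \<le> ennreal (l ^ ?n)" unfolding emeasure_cube[OF less_imp_le[OF l]] .
      have "(\<integral>\<^sup>+y\<in>B. ennreal (g y powr q) \<partial>lebesgue) = (\<integral>\<^sup>+y\<in>B. ennreal (w y powr q) \<partial>lebesgue)"
        by (intro nn_integral_cong) (auto simp: indicator_def B_def g_def)
      then show "(\<integral>\<^sup>+y\<in>B. ennreal (g y powr q) \<partial>lebesgue) \<le> ennreal (K * t powr q * l ^ ?n)"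
        using elim xB by (simp add: B_def t_def)
    qed auto
    also have "\<dots> = ennreal (t powr a * l ^ ?n + t powr (a - q) * (K * t powr q * l ^ ?n))"
      using K l by (simp add: ennreal_mult[symmetric])
    also have "t powr a * l ^ ?n + t powr (a - q) * (K * t powr q * l ^ ?n) = (1 + K) * t powr a * l ^ ?n"
      using t by (simp add: powr_diff field_simps)
    finally show ?concl by (simp add: B_def t_def)
    qed
  qed
  moreover have "(\<lambda>x. if x \<in> Q0 then w x powr a else 0) \<in> borel_measurable lebesgue"
  proof -
    have "(\<lambda>x. if x \<in> Q0 then w x powr a else 0) = (\<lambda>x. g x powr a)" by (auto simp: g_def)
    then show ?thesis by simp
  qed
  moreover have "AE x in lebesgue. x \<in> Q0 \<longrightarrow> 0 < w x powr a" using pos by eventually_elim auto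
  moreover have "1 + K > 0" using K(1) by simp
  ultimately show ?thesis unfolding A1_iff[OF Q0] by blast
qed

section \<open>Singularities and log-Hoelder exponents\<close>

text \<open>
  Away from its singularities \<open>w\<close> is locally essentially bounded; compactness of the remaining part
  of the closed cube makes this uniform.
\<close>
lemma ess_bounded_off_singularities:
  fixes Q0 :: "'a::euclidean_space set"
  assumes Q0: "Q0 \<in> sets lebesgue" "bounded Q0" and V: "open V" "singularities Q0 w \<subseteq> V"
  obtains M where "AE x in lebesgue. x \<in> Q0 - V \<longrightarrow> w x \<le> M"
proof -
  define S where "S = closure Q0 - V"
  have "compact S" unfolding S_def using Q0 V by (simp add: compact_diff)
  have "\<forall>x\<in>S. \<exists>U M. open U \<and> x \<in> U \<and> (AE y in lebesgue. y \<in> U \<inter> Q0 \<longrightarrow> \<bar>w y\<bar> \<le> M)"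
  proof
    fix x assume "x \<in> S"
    then obtain U where U: "open U" "x \<in> U" "ess_bounded_on (U \<inter> Q0) w"
      using V unfolding S_def singularities_def by blast
    moreover have "U \<inter> Q0 \<in> sets lebesgue" using U Q0 by auto
    ultimately show "\<exists>U M. open U \<and> x \<in> U \<and> (AE y in lebesgue. y \<in> U \<inter> Q0 \<longrightarrow> \<bar>w y\<bar> \<le> M)"
      unfolding ess_bounded_on_def using AE_restrict_space_iff[of "U \<inter> Q0" lebesgue] by auto
  qed
  then obtain U M where UM: "\<And>x. x \<in> S \<Longrightarrow> open (U x)" "\<And>x. x \<in> S \<Longrightarrow> x \<in> U x"
     "\<And>x. x \<in> S \<Longrightarrow> AE y in lebesgue. y \<in> U x \<inter> Q0 \<longrightarrow> \<bar>w y\<bar> \<le> M x"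
    by metis
  obtain D where D: "D \<subseteq> S" "finite D" "S \<subseteq> (\<Union>x\<in>D. U x)"
    using compactE_image[OF \<open>compact S\<close>, of S U] UM(1,2) by blast
  have "AE y in lebesgue. \<forall>x\<in>D. y \<in> U x \<inter> Q0 \<longrightarrow> \<bar>w y\<bar> \<le> M x"
    using UM(3) D(1) by (subst AE_finite_all[OF D(2)]) blast
  then have "AE y in lebesgue. y \<in> Q0 - V \<longrightarrow> w y \<le> (\<Sum>x\<in>D. \<bar>M x\<bar>)"
  proof (rule eventually_mono, intro impI)
    fix y assume *: "\<forall>x\<in>D. y \<in> U x \<inter> Q0 \<longrightarrow> \<bar>w y\<bar> \<le> M x" and y: "y \<in> Q0 - V"
    have "y \<in> S" using y closure_subset by (auto simp: S_def)
    then obtain x where x: "x \<in> D" "y \<in> U x" using D by blast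
    then have "w y \<le> \<bar>M x\<bar>" using * y by force
    also have "\<dots> \<le> (\<Sum>x\<in>D. \<bar>M x\<bar>)" using x D by (intro member_le_sum) auto
    finally show "w y \<le> (\<Sum>x\<in>D. \<bar>M x\<bar>)" .
  qed
  then show thesis using that by blast
qed

text \<open>
  Continuity gives measurability of \<open>\<alpha>\<close>, and makes its values at the individual points \<open>p i\<close>
  subject to bounds that are only assumed almost everywhere.
\<close>
lemma log_holder_imp_continuous_on:
  assumes "log_holder_on Q0 \<alpha>"
  shows "continuous_on Q0 \<alpha>"
proof -
  obtain C where C: "C > 0" "\<And>x y. x \<in> Q0 \<Longrightarrow> y \<in> Q0 \<Longrightarrow> norm (x - y) \<le> 1/2 \<Longrightarrow> \<bar>\<alpha> x - \<alpha> y\<bar> \<le> C / ln (1 / norm (x - y))"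
    using assms unfolding log_holder_on_def by blast
  show ?thesis unfolding continuous_on_iff
  proof (intro ballI allI impI)
    fix x and e :: real assume x: "x \<in> Q0" and e: "e > 0"
    show "\<exists>d>0. \<forall>y\<in>Q0. dist y x < d \<longrightarrow> dist (\<alpha> y) (\<alpha> x) < e"
    proof (intro exI[of _ "min (1/2) (exp (- (C / e)))"] conjI ballI impI)
      fix y assume y: "y \<in> Q0" and d: "dist y x < min (1/2) (exp (- (C / e)))"
      show "dist (\<alpha> y) (\<alpha> x) < e"
      proof (cases "y = x")
        case False
        define r where "r = norm (y - x)"
        have r: "r > 0" "r \<le> 1/2" "r < exp (- (C / e))" using False d by (auto simp: r_def dist_norm)
        have "ln r < - (C / e)" using r by (metis ln_exp ln_less_cancel_iff exp_gt_zero)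
        then have l: "C / e < ln (1 / r)" using r by (simp add: ln_div)
        have "C / e > 0" using C e by simp
        then have "ln (1 / r) > 0" using l by linarith
        then have "C / ln (1 / r) < e" using e l by (simp add: pos_divide_less_eq mult.commute)
        then show ?thesis using C(2)[OF y x] r by (simp add: r_def dist_real_def)
      qed (use e in simp)
    qed simp
  qed
qed

text \<open>
  Every neighbourhood of a point of \<open>Q0\<close>, even of a boundary point, meets the open cube in a set of
  positive measure.
\<close>
lemma continuous_on_cube_AE_imp_mem:
  fixes Q0 :: "'a::euclidean_space set" and \<alpha> :: "'a \<Rightarrow> real"
  assumes cube: "is_cube Q0" and cont: "continuous_on Q0 \<alpha>" and p: "p \<in> Q0"
    and ae: "AE x in lebesgue. x \<in> Q0 \<longrightarrow> \<alpha> x \<in> S" and S: "closed S"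
  shows "\<alpha> p \<in> S"
proof (rule ccontr)
  assume "\<alpha> p \<notin> S"
  then obtain U where U: "open U" "U \<inter> Q0 = \<alpha> -` (- S) \<inter> Q0"
    using cont S unfolding continuous_on_open_invariant by (metis open_Compl)
  have pU: "p \<in> U" using U p \<open>\<alpha> p \<notin> S\<close> by blast
  obtain c L where Q: "cube c L \<subseteq> Q0" "Q0 \<subseteq> closure (cube c L)"
    using is_cubeE[OF cube] by metis
  have "U \<inter> cube c L \<noteq> {}" using pU p Q U(1) by (metis open_Int_closure_eq_empty disjoint_iff subsetD)
  moreover have "open (U \<inter> cube c L)" using U by auto
  moreover have "negligible (U \<inter> cube c L)"
  proof -
    have "AE x in lebesgue. x \<notin> U \<inter> cube c L"
      using ae by (rule eventually_mono) (use U Q in blast)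
    then show ?thesis unfolding negligible_iff_null_sets
      using AE_iff_null_sets[of "U \<inter> cube c L" lebesgue] U by auto
  qed
  ultimately show False using open_not_negligible by blast
qed

text \<open>
  The reason for the log-Hoelder condition: an exponent may be changed by \<open>C / ln (1 / d)\<close> at
  distance \<open>d\<close> from a singularity of size \<open>d powr - \<theta>\<close>, because
  \<open>(d powr - \<theta>) powr (C / ln (1 / d)) = exp (C * \<theta>)\<close> does not depend on \<open>d\<close>.
\<close>
lemma powr_comparable_exponents:
  fixes W d \<theta> C a a' :: real
  assumes "1 \<le> W" "W \<le> d powr (- \<theta>)" "0 < d" "d \<le> 1/2" "\<bar>a - a'\<bar> \<le> C / ln (1 / d)"
  shows "W powr a \<le> exp (C * \<theta>) * W powr a'"
proof -
  have ld: "ln (1 / d) > 0" using assms by simp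
  have "ln W \<le> ln (d powr (- \<theta>))" using assms by (subst ln_le_cancel_iff) auto
  also have "\<dots> = \<theta> * ln (1 / d)" using assms by (simp add: ln_powr ln_div)
  finally have lW: "ln W \<le> \<theta> * ln (1 / d)" .
  have "(a - a') * ln W \<le> \<bar>a - a'\<bar> * ln W" using assms by (intro mult_right_mono) auto
  also have "\<dots> \<le> C / ln (1 / d) * (\<theta> * ln (1 / d))"
    using assms lW by (intro mult_mono) auto
  also have "\<dots> = C * \<theta>" using ld by simp
  finally have "exp ((a - a') * ln W) \<le> exp (C * \<theta>)" by simp
  then have "W powr (a - a') \<le> exp (C * \<theta>)" using assms by (simp add: powr_def)
  then have "W powr (a - a') * W powr a' \<le> exp (C * \<theta>) * W powr a'" by (rule mult_right_mono) simp
  then show ?thesis by (simp flip: powr_add)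
qed

section \<open>Variable powers\<close>

lemma cube_subset_ball_of_mem:
  fixes z q :: "'a::euclidean_space"
  assumes y: "y \<in> cube z l" "y \<in> ball q (d / 2)" and l: "l \<le> d / (2 * real DIM('a))"
  shows "cube z l \<subseteq> ball q d"
proof
  fix x assume "x \<in> cube z l"
  then have "dist z x \<le> real DIM('a) * l / 2" "dist z y \<le> real DIM('a) * l / 2"
    using y(1) cube_subset_cball[of z l] by (auto simp: subset_eq)
  then have "dist y x \<le> real DIM('a) * l"
    using dist_triangle[of y x z] by (simp add: dist_commute)
  moreover have "real DIM('a) * l \<le> d / 2" using l by (simp add: field_simps)
  moreover have "dist q x \<le> dist q y + dist y x" by (rule dist_triangle)
  ultimately show "x \<in> ball q d" using y(2) by simp
qed

text \<open>
  Comparable weights satisfy the same \<open>A1\<close> inequality on a set; comparability is used once to enlarge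
  the integrand and once to shrink the value at \<open>x\<close>, which costs \<open>k\<close> squared.
\<close>
lemma A1_bound_of_comparable:
  fixes v v' :: "'a::euclidean_space \<Rightarrow> real"
  assumes B: "B \<in> sets lebesgue" and le: "AE x in lebesgue. x \<in> B \<longrightarrow> v x \<le> k * v' x \<and> v' x \<le> k * v x"
    and k: "k \<ge> 0" and K: "K \<ge> 0" and L: "L \<ge> 0"
    and m: "(\<lambda>x. ennreal (v' x) * indicator B x) \<in> borel_measurable lebesgue"
    and A1: "AE x in lebesgue. x \<in> B \<longrightarrow> (\<integral>\<^sup>+y\<in>B. ennreal (v' y) \<partial>lebesgue) \<le> ennreal (K * v' x * L)"
  shows "AE x in lebesgue. x \<in> B \<longrightarrow> (\<integral>\<^sup>+y\<in>B. ennreal (v y) \<partial>lebesgue) \<le> ennreal (k * K * k * v x * L)"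
proof -
  have "(\<integral>\<^sup>+y\<in>B. ennreal (v y) \<partial>lebesgue) \<le> (\<integral>\<^sup>+y. ennreal k * (ennreal (v' y) * indicator B y) \<partial>lebesgue)"
    using le
  proof (intro nn_integral_mono_AE, eventually_elim)
    case (elim y)
    then show ?case using k by (cases "y \<in> B") (auto simp: ennreal_mult'[symmetric] intro!: ennreal_leI)
  qed
  also have "\<dots> = ennreal k * (\<integral>\<^sup>+y\<in>B. ennreal (v' y) \<partial>lebesgue)" using m by (rule nn_integral_cmult)
  finally have I: "(\<integral>\<^sup>+y\<in>B. ennreal (v y) \<partial>lebesgue) \<le> ennreal k * (\<integral>\<^sup>+y\<in>B. ennreal (v' y) \<partial>lebesgue)" .
  show ?thesis using le A1
  proof eventually_elim
    case (elim x)
    show ?case (is "_ \<longrightarrow> ?concl")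
    proof
      assume x: "x \<in> B"
      note I
      also have "ennreal k * (\<integral>\<^sup>+y\<in>B. ennreal (v' y) \<partial>lebesgue) \<le> ennreal k * ennreal (K * v' x * L)"
        using elim x by (intro mult_left_mono) auto
      also have "\<dots> = ennreal (k * (K * v' x * L))" using k by (simp add: ennreal_mult')
      also have "\<dots> \<le> ennreal (k * (K * (k * v x) * L))"
        using elim x k K L by (intro ennreal_leI mult_left_mono mult_right_mono) auto
      finally show ?concl by (simp add: mult_ac)
    qed
  qed
qed

theorem theorem1p12:
  fixes Q0 :: "'a::euclidean_space set"
    and w :: "'a \<Rightarrow> real"
    and m :: nat
    and p :: "nat \<Rightarrow> 'a"
    and \<theta> r :: real
  assumes "is_cube Q0"
    and "w \<in> A1 Q0"
    and "AE x in lebesgue_on Q0. w x \<ge> 1"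
    and "inj_on p {1..m}"
    and "singularities Q0 w = p ` {1..m}"
    and "p ` {1..m} \<subseteq> Q0"
    and "\<theta> > 0"
    and "r > 0"
    and "\<And>i. i \<in> {1..m} \<Longrightarrow>
           AE x in lebesgue_on (cube (p i) r \<inter> closure Q0). w x \<le> norm (x - p i) powr (- \<theta>)"
  shows "\<exists>\<delta>>0. \<forall>\<alpha> :: 'a \<Rightarrow> real.
           log_holder_on Q0 \<alpha> \<and> (AE x in lebesgue_on Q0. 1 \<le> \<alpha> x \<and> \<alpha> x \<le> 1 + \<delta>)
             \<longrightarrow> (\<lambda>x. w x powr \<alpha> x) \<in> A1 Q0"
proof -
  let ?n = "DIM('a)"
  have Q0: "Q0 \<in> sets lebesgue" using is_cubeE[OF assms(1)] by metis
  have bQ0: "bounded Q0"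
    using assms(1) unfolding is_cube_def cube_def by (meson bounded_box bounded_closure bounded_subset)
  have w: "weight_on Q0 w" using assms(2) by (simp add: A1_def)
  then have wm: "w \<in> borel_measurable (lebesgue_on Q0)" by (simp add: weight_on_def)
  have w1: "AE x in lebesgue. x \<in> Q0 \<longrightarrow> 1 \<le> w x"
    using assms(3) Q0 by (simp add: AE_restrict_space_iff)
  obtain \<delta> where \<delta>: "\<delta> > 0" "(\<lambda>x. w x powr (1 + \<delta>)) \<in> A1 Q0"
    using A1_self_improvement[OF assms(1,2)] by blast
  define \<rho> where "\<rho> = min (1/2) (r / 2)"
  have \<rho>: "\<rho> > 0" "\<rho> \<le> 1/2" "\<rho> \<le> r / 2" using assms(8) by (auto simp: \<rho>_def)
  \<comment> \<open>Half the radius, so that a small cube meeting V lies in the full ball around some p i.\<close>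
  define V where "V = (\<Union>i\<in>{1..m}. ball (p i) (\<rho> / 2))"
  have "open V" "singularities Q0 w \<subseteq> V" using \<rho> assms(5) by (auto simp: V_def)
  then obtain M where M: "AE x in lebesgue. x \<in> Q0 - V \<longrightarrow> w x \<le> M"
    using ess_bounded_off_singularities[OF Q0 bQ0] by blast
  have "(\<lambda>x. w x powr \<alpha> x) \<in> A1 Q0"
    if lh: "log_holder_on Q0 \<alpha>" and "AE x in lebesgue_on Q0. 1 \<le> \<alpha> x \<and> \<alpha> x \<le> 1 + \<delta>" for \<alpha>
  proof -
    have \<alpha>: "AE x in lebesgue. x \<in> Q0 \<longrightarrow> \<alpha> x \<in> {1..1 + \<delta>}"
      unfolding atLeastAtMost_iff using that(2) by (rule AE_restrict_space_iff[THEN iffD1, rotated]) (use Q0 in simp)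
    have cont: "continuous_on Q0 \<alpha>" using lh by (rule log_holder_imp_continuous_on)
    have \<alpha>m: "\<alpha> \<in> borel_measurable (lebesgue_on Q0)"
      using continuous_imp_measurable_on_sets_lebesgue[OF cont Q0] .
    obtain C where C: "C > 0" "\<And>x y. x \<in> Q0 \<Longrightarrow> y \<in> Q0 \<Longrightarrow> norm (x - y) \<le> 1/2 \<Longrightarrow> \<bar>\<alpha> x - \<alpha> y\<bar> \<le> C / ln (1 / norm (x - y))"
      using lh unfolding log_holder_on_def by blast
    \<comment> \<open>The constants below may depend on \<open>\<alpha>\<close>; only \<open>\<delta>\<close> has been fixed before it.\<close>
    define v where "v = (\<lambda>x. w x powr \<alpha> x)"
    have vm: "v \<in> borel_measurable (lebesgue_on Q0)" unfolding v_def using wm \<alpha>m by measurable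
    have v1: "AE x in lebesgue. x \<in> Q0 \<longrightarrow> 1 \<le> v x"
      using w1 \<alpha> by eventually_elim (auto simp: v_def ge_one_powr_ge_zero)
    have vle: "AE x in lebesgue. x \<in> Q0 \<longrightarrow> v x \<le> w x powr (1 + \<delta>)"
      using w1 \<alpha> by eventually_elim (auto simp: v_def intro!: powr_mono)
    have fin: "(\<integral>\<^sup>+y\<in>Q0. ennreal (v y) \<partial>lebesgue) < \<infinity>"
    proof -
      have "(\<integral>\<^sup>+y\<in>Q0. ennreal (v y) \<partial>lebesgue) \<le> (\<integral>\<^sup>+y\<in>Q0. ennreal (w y powr (1 + \<delta>)) \<partial>lebesgue)"
        using vle by (intro nn_integral_mono_AE, eventually_elim) (auto simp: indicator_def intro!: ennreal_leI)
      also have "\<dots> < \<infinity>" using A1_integral_finite[OF assms(1) \<delta>(2)] .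
      finally show ?thesis .
    qed
    define k where "k = exp (C * \<theta>)"
    have k: "k \<ge> 1" using C assms(7) by (simp add: k_def)
    have p_mem: "p i \<in> Q0" if "i \<in> {1..m}" for i using that assms(6) by blast
    have \<alpha>p: "1 \<le> \<alpha> (p i)" "\<alpha> (p i) \<le> 1 + \<delta>" if "i \<in> {1..m}" for i
      using continuous_on_cube_AE_imp_mem[OF assms(1) cont p_mem[OF that] \<alpha>] by auto
    have comparable: "AE x in lebesgue. x \<in> Q0 \<inter> ball (p i) \<rho> \<longrightarrow>
        v x \<le> k * w x powr \<alpha> (p i) \<and> w x powr \<alpha> (p i) \<le> k * v x" if i: "i \<in> {1..m}" for i
    proof -
      have "cube (p i) r \<inter> closure Q0 \<in> sets lebesgue" by auto
      then have "AE x in lebesgue. x \<in> cube (p i) r \<inter> closure Q0 \<longrightarrow> w x \<le> norm (x - p i) powr (- \<theta>)"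
        using assms(9)[OF i] AE_restrict_space_iff[of "cube (p i) r \<inter> closure Q0" lebesgue] by simp
      moreover have "AE x in lebesgue. x \<noteq> p i"
        by (rule AE_completion) (simp add: AE_lborel_singleton)
      ultimately show ?thesis using w1
      proof eventually_elim
        case (elim x)
        show ?case
        proof
          assume x: "x \<in> Q0 \<inter> ball (p i) \<rho>"
          define d where "d = norm (x - p i)"
          have d: "0 < d" "d \<le> 1/2" using elim x \<rho> by (auto simp: d_def dist_norm norm_minus_commute)
          have "x \<in> cube (p i) r" using x ball_subset_cube[OF \<rho>(3)] by blast
          then have W: "1 \<le> w x" "w x \<le> d powr (- \<theta>)"
            using elim x closure_subset[of Q0] by (auto simp: d_def)
          have "\<bar>\<alpha> x - \<alpha> (p i)\<bar> \<le> C / ln (1 / d)"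
            using C(2)[of x "p i"] x p_mem[OF i] d by (simp add: d_def)
          then have "\<bar>\<alpha> x - \<alpha> (p i)\<bar> \<le> C / ln (1 / d)" "\<bar>\<alpha> (p i) - \<alpha> x\<bar> \<le> C / ln (1 / d)"
            by (simp_all add: abs_minus_commute)
          then show "v x \<le> k * w x powr \<alpha> (p i) \<and> w x powr \<alpha> (p i) \<le> k * v x"
            unfolding v_def k_def using powr_comparable_exponents[OF W d] by blast
        qed
      qed
    qed
    define A1_const where "A1_const = (\<lambda>i K. K \<ge> 0 \<and> (\<forall>z\<in>Q0. \<forall>l>0. AE x in lebesgue. x \<in> cube z l \<inter> Q0 \<longrightarrow>
        (\<integral>\<^sup>+y\<in>cube z l \<inter> Q0. ennreal (w y powr \<alpha> (p i)) \<partial>lebesgue) \<le> ennreal (K * w x powr \<alpha> (p i) * l ^ ?n)))"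
    have "\<exists>K. A1_const i K" if i: "i \<in> {1..m}" for i
    proof -
      have "(\<lambda>x. w x powr \<alpha> (p i)) \<in> A1 Q0"
        using A1_powr_interpolation[OF Q0 w \<delta>(2)] \<alpha>p[OF i] by auto
      then show ?thesis unfolding A1_iff[OF Q0] A1_const_def by (meson less_imp_le)
    qed
    then obtain K where "\<And>i. i \<in> {1..m} \<Longrightarrow> A1_const i (K i)" by metis
    then have K: "\<And>i. i \<in> {1..m} \<Longrightarrow> K i \<ge> 0"
        "\<And>i z l. i \<in> {1..m} \<Longrightarrow> z \<in> Q0 \<Longrightarrow> l > 0 \<Longrightarrow> AE x in lebesgue. x \<in> cube z l \<inter> Q0 \<longrightarrow>
        (\<integral>\<^sup>+y\<in>cube z l \<inter> Q0. ennreal (w y powr \<alpha> (p i)) \<partial>lebesgue) \<le> ennreal (K i * w x powr \<alpha> (p i) * l ^ ?n)"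
      unfolding A1_const_def by blast+
    define M' where "M' = max 1 M powr (1 + \<delta>)"
    define D where "D = M' + (\<Sum>i\<in>{1..m}. k * K i * k)"
    have M': "M' \<ge> 0" by (simp add: M'_def)
    have nn: "0 \<le> k * K i * k" if "i \<in> {1..m}" for i using k K(1)[OF that] by simp
    have D: "M' \<le> D" "\<And>i. i \<in> {1..m} \<Longrightarrow> k * K i * k \<le> D"
    proof -
      have "0 \<le> (\<Sum>i\<in>{1..m}. k * K i * k)" by (rule sum_nonneg) (rule nn)
      then show "M' \<le> D" by (simp add: D_def)
      fix i assume "i \<in> {1..m}"
      then have "k * K i * k \<le> (\<Sum>i\<in>{1..m}. k * K i * k)" by (intro member_le_sum nn) auto
      then show "k * K i * k \<le> D" using M' by (simp add: D_def)
    qed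
    have small: "AE x in lebesgue. x \<in> cube z l \<inter> Q0 \<longrightarrow>
        (\<integral>\<^sup>+y\<in>cube z l \<inter> Q0. ennreal (v y) \<partial>lebesgue) \<le> ennreal (D * v x * l ^ ?n)"
      if z: "z \<in> Q0" and l: "0 < l" "l \<le> \<rho> / (2 * real ?n)" for z l
    proof -
      let ?B = "cube z l \<inter> Q0"
      have B: "?B \<in> sets lebesgue" using Q0 by auto
      obtain D' where D': "D' \<le> D" and bound: "AE x in lebesgue. x \<in> ?B \<longrightarrow>
        (\<integral>\<^sup>+y\<in>?B. ennreal (v y) \<partial>lebesgue) \<le> ennreal (D' * v x * l ^ ?n)"
      \<comment> \<open>A small cube either lies close to one singularity, where the exponent may be frozen, or
        avoids all of them, where the weight is bounded.\<close>
      proof (cases "?B \<inter> V = {}")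
        case False
        then obtain i y where i: "i \<in> {1..m}" "y \<in> cube z l" "y \<in> ball (p i) (\<rho> / 2)"
          unfolding V_def by blast
        have "cube z l \<subseteq> ball (p i) \<rho>" using cube_subset_ball_of_mem[OF i(2,3) l(2)] .
        then have "AE x in lebesgue. x \<in> ?B \<longrightarrow> v x \<le> k * w x powr \<alpha> (p i) \<and> w x powr \<alpha> (p i) \<le> k * v x"
          using comparable[OF i(1)] by (auto elim!: eventually_mono)
        then have "AE x in lebesgue. x \<in> ?B \<longrightarrow>
            (\<integral>\<^sup>+y\<in>?B. ennreal (v y) \<partial>lebesgue) \<le> ennreal (k * K i * k * v x * l ^ ?n)"
        proof (rule A1_bound_of_comparable[OF B])
          show "(\<lambda>x. ennreal (w x powr \<alpha> (p i)) * indicator ?B x) \<in> borel_measurable lebesgue"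
          proof -
            have [measurable]: "(\<lambda>x. if x \<in> Q0 then w x else 0) \<in> borel_measurable lebesgue"
              using wm borel_measurable_if[OF Q0] by blast
            have "(\<lambda>x. ennreal (w x powr \<alpha> (p i)) * indicator ?B x)
                = (\<lambda>x. ennreal ((if x \<in> Q0 then w x else 0) powr \<alpha> (p i)) * indicator ?B x)"
              by (auto simp: indicator_def)
            then show ?thesis using B by simp
          qed
        qed (use k K i l z in auto)
        then show thesis using that D(2)[OF i(1)] by blast
      next
        case True
        have vM: "AE x in lebesgue. x \<in> ?B \<longrightarrow> v x \<le> M'"
          using M vle w1
        proof eventually_elim
          case (elim x)
          show ?case
          proof
            assume x: "x \<in> ?B"
            then have "x \<in> Q0 - V" using True by blast
            then have "w x powr (1 + \<delta>) \<le> M'" unfolding M'_def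
              using elim \<delta>(1) by (intro powr_mono2) auto
            then show "v x \<le> M'" using elim x by auto
          qed
        qed
        have "(\<integral>\<^sup>+y\<in>?B. ennreal (v y) \<partial>lebesgue) \<le> (\<integral>\<^sup>+y. ennreal M' * indicator (cube z l) y \<partial>lebesgue)"
          using vM by (intro nn_integral_mono_AE, eventually_elim) (auto simp: indicator_def intro!: ennreal_leI)
        also have "\<dots> = ennreal M' * emeasure lebesgue (cube z l)"
          by (rule nn_integral_cmult_indicator) simp
        also have "\<dots> = ennreal (M' * l ^ ?n)"
          unfolding emeasure_cube[OF less_imp_le[OF l(1)]] using l M' by (simp add: ennreal_mult)
        finally have I: "(\<integral>\<^sup>+y\<in>?B. ennreal (v y) \<partial>lebesgue) \<le> ennreal (M' * l ^ ?n)" .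
        have "AE x in lebesgue. x \<in> ?B \<longrightarrow> (\<integral>\<^sup>+y\<in>?B. ennreal (v y) \<partial>lebesgue) \<le> ennreal (M' * v x * l ^ ?n)"
          using v1
        proof (rule eventually_mono, intro impI)
          fix x assume x: "x \<in> Q0 \<longrightarrow> 1 \<le> v x" "x \<in> ?B"
          then have "M' * 1 * l ^ ?n \<le> M' * v x * l ^ ?n"
            using M' l by (intro mult_right_mono mult_left_mono) auto
          then show "(\<integral>\<^sup>+y\<in>?B. ennreal (v y) \<partial>lebesgue) \<le> ennreal (M' * v x * l ^ ?n)"
            using I by (simp add: order_trans[OF _ ennreal_leI])
        qed
        then show thesis using that D(1) by blast
      qed
      show ?thesis using bound v1
      proof eventually_elim
        case (elim x)
        show ?case (is "_ \<longrightarrow> ?concl")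
        proof
          assume x: "x \<in> ?B"
          have "D' * v x * l ^ ?n \<le> D * v x * l ^ ?n"
            using D' elim x l by (intro mult_right_mono) auto
          then show ?concl using elim x by (meson ennreal_leI order_trans)
        qed
      qed
    qed
    have "\<rho> / (2 * real ?n) > 0" using \<rho> by simp
    then show ?thesis
      using A1_of_small_cubes[OF Q0 vm v1 fin _ small] unfolding v_def by blast
  qed
  then show ?thesis using \<delta>(1) by blast
qed

end
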